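(* Let $N\in\mathbb N$ be odd, $S=\{-1,+1\}^N$, $H(\sigma)=-\frac1{2N}\sum_{i,j=1}^N\sigma_i\sigma_j$, let $\mu$ be the uniform distribution on $S$, and let $\mu_t(\sigma)=Z_t^{-1}e^{-tH(\sigma)}\mu(\sigma)$ with $Z_t=\sum_\sigma e^{-tH(\sigma)}\mu(\sigma)$ (mean field Ising model). Let $\mathcal L_t$ be the generator of the continuous-time Metropolis chain with respect to $\mu_t$ based on the nearest neighbor random walk on $S$ as proposal matrix. Let $\nu$ be a probability measure on $S$, $\nu_t=\Phi_{0,t}\nu$ and $\varepsilon_t=\sum_{\sigma\in S}\big(\frac{\nu_t(\sigma)}{\mu_t(\sigma)}-1\big)^2\mu_t(\sigma)$. Then for every $\beta>0$, $$\sup_{0\le t\le\beta}\varepsilon_t\le e^2\cdot\varepsilon_0$$ holds whenever $\varepsilon_0\le1$ and $$M_t\ge\frac94\,N^3+\frac98\,\beta\,N^4\qquad\forall\,t\in(0,\beta).$$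
   Context: The Metropolis generator with symmetric proposal matrix $K$ is $\mathcal L_t(\sigma,\sigma')=K(\sigma,\sigma')\min\big(\mu_t(\sigma')/\mu_t(\sigma),1\big)$ for $\sigma\ne\sigma'$ and $\mathcal L_t(\sigma,\sigma)=-\sum_{\sigma'\ne\sigma}\mathcal L_t(\sigma,\sigma')$. For the nearest neighbor random walk on the hypercube, $K(\sigma,\sigma')=1/N$ if $\sigma,\sigma'$ differ in exactly one coordinate and $K(\sigma,\sigma')=0$ otherwise. $t\mapsto M_t\in[0,\infty)$ is a continuous function on $[0,\infty)$. $p_{s,t}$ ($0\le s\le t$) is the unique matrix solution of $\frac{\partial}{\partial t}p_{s,t}f=p_{s,t}(M_t\mathcal L_tf-Hf)$, $p_{s,s}f=f$ for all $f:S\to\mathbb R$, where $(\mathcal L_tf)(x)=\sum_y\mathcal L_t(x,y)f(y)$. For a probability measure $\nu$ on $S$, $\Phi_{s,t}\nu:=\dfrac{\nu p_{s,t}}{(\nu p_{s,t})(S)}$, where $(\nu p)(y)=\sum_x\nu(x)p(x,y)$. (Adding a constant to $H$ changes neither $\mu_t$ nor $\Phi_{s,t}$.) *)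

theory Defs
  imports "HOL-Probability.Probability"
begin

text \<open>Measures and matrices on a finite state space \<open>S\<close> are represented by their weights and
  entries; only the values on \<open>S\<close> matter. The action of a matrix on a function is
  \<open>(A f)(x) = \<Sum>y\<in>S. A(x,y) f(y)\<close>, that of a measure on a matrix \<open>(\<nu> A)(y) = \<Sum>x\<in>S. \<nu>(x) A(x,y)\<close>.\<close>

definition mat_fun :: "'s set \<Rightarrow> ('s \<Rightarrow> 's \<Rightarrow> real) \<Rightarrow> ('s \<Rightarrow> real) \<Rightarrow> 's \<Rightarrow> real" where
  "mat_fun S A f x = (\<Sum>y\<in>S. A x y * f y)"

definition meas_mat :: "'s set \<Rightarrow> ('s \<Rightarrow> real) \<Rightarrow> ('s \<Rightarrow> 's \<Rightarrow> real) \<Rightarrow> 's \<Rightarrow> real" where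
  "meas_mat S \<nu> A y = (\<Sum>x\<in>S. \<nu> x * A x y)"

definition gibbs :: "'s set \<Rightarrow> ('s \<Rightarrow> real) \<Rightarrow> ('s \<Rightarrow> real) \<Rightarrow> real \<Rightarrow> 's \<Rightarrow> real" where
  "gibbs S H \<mu> t \<sigma> = exp (- t * H \<sigma>) * \<mu> \<sigma> / (\<Sum>\<tau>\<in>S. exp (- t * H \<tau>) * \<mu> \<tau>)"

definition metropolis_gen ::
  "'s set \<Rightarrow> ('s \<Rightarrow> 's \<Rightarrow> real) \<Rightarrow> ('s \<Rightarrow> real) \<Rightarrow> 's \<Rightarrow> 's \<Rightarrow> real" where
  "metropolis_gen S K \<pi> \<sigma> \<sigma>' =
     (if \<sigma> \<noteq> \<sigma>' then K \<sigma> \<sigma>' * min (\<pi> \<sigma>' / \<pi> \<sigma>) 1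
      else - (\<Sum>\<tau>\<in>S - {\<sigma>}. K \<sigma> \<tau> * min (\<pi> \<tau> / \<pi> \<sigma>) 1))"

text \<open>\<open>p s t\<close> (\<open>0 \<le> s \<le> t\<close>) is a matrix solution on \<open>S\<close> of the linear evolution equation
  \<open>\<partial>/\<partial>t p\<^sub>s\<^sub>,\<^sub>t f = p\<^sub>s\<^sub>,\<^sub>t (M\<^sub>t L\<^sub>t f - H f)\<close>, \<open>p\<^sub>s\<^sub>,\<^sub>s f = f\<close>. The derivative is one-sided at \<open>t = s\<close>.
  For continuous \<open>M\<close> and \<open>L\<close> this determines \<open>p s t\<close> on \<open>S \<times> S\<close> for \<open>0 \<le> s \<le> t\<close>.\<close>

definition is_propagator ::
  "'s set \<Rightarrow> (real \<Rightarrow> real) \<Rightarrow> (real \<Rightarrow> 's \<Rightarrow> 's \<Rightarrow> real) \<Rightarrow> ('s \<Rightarrow> real)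
     \<Rightarrow> (real \<Rightarrow> real \<Rightarrow> 's \<Rightarrow> 's \<Rightarrow> real) \<Rightarrow> bool" where
  "is_propagator S M L H p \<longleftrightarrow>
     (\<forall>s\<ge>0. \<forall>f. \<forall>x\<in>S.
        mat_fun S (p s s) f x = f x \<and>
        (\<forall>t\<ge>s. ((\<lambda>u. mat_fun S (p s u) f x) has_real_derivative
                  mat_fun S (p s t) (\<lambda>y. M t * mat_fun S (L t) f y - H y * f y) x)
                (at t within {s..})))"

definition Phi ::
  "'s set \<Rightarrow> (real \<Rightarrow> real \<Rightarrow> 's \<Rightarrow> 's \<Rightarrow> real) \<Rightarrow> real \<Rightarrow> real \<Rightarrow> ('s \<Rightarrow> real) \<Rightarrow> 's \<Rightarrow> real" where
  "Phi S p s t \<nu> y = meas_mat S \<nu> (p s t) y / (\<Sum>z\<in>S. meas_mat S \<nu> (p s t) z)"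

definition chi_square :: "'s set \<Rightarrow> ('s \<Rightarrow> real) \<Rightarrow> ('s \<Rightarrow> real) \<Rightarrow> real" where
  "chi_square S \<nu> \<pi> = (\<Sum>\<sigma>\<in>S. (\<nu> \<sigma> / \<pi> \<sigma> - 1)\<^sup>2 * \<pi> \<sigma>)"

text \<open>Extensional functions represent \<open>{-1,+1}\<^sup>N\<close> with exactly one element per configuration.\<close>

definition spins :: "nat \<Rightarrow> (nat \<Rightarrow> real) set" where
  "spins N = {1..N} \<rightarrow>\<^sub>E {-1, 1}"

definition hypercube_kernel :: "nat \<Rightarrow> (nat \<Rightarrow> real) \<Rightarrow> (nat \<Rightarrow> real) \<Rightarrow> real" where
  "hypercube_kernel N \<sigma> \<sigma>' = (if card {i\<in>{1..N}. \<sigma> i \<noteq> \<sigma>' i} = 1 then 1 / real N else 0)"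

definition ising_H :: "nat \<Rightarrow> (nat \<Rightarrow> real) \<Rightarrow> real" where
  "ising_H N \<sigma> = - (1 / (2 * real N)) * (\<Sum>i=1..N. \<Sum>j=1..N. \<sigma> i * \<sigma> j)"

definition ising_mu :: "nat \<Rightarrow> real \<Rightarrow> (nat \<Rightarrow> real) \<Rightarrow> real" where
  "ising_mu N = gibbs (spins N) (ising_H N) (pmf (pmf_of_set (spins N)))"

definition ising_gen :: "nat \<Rightarrow> real \<Rightarrow> (nat \<Rightarrow> real) \<Rightarrow> (nat \<Rightarrow> real) \<Rightarrow> real" where
  "ising_gen N t = metropolis_gen (spins N) (hypercube_kernel N) (ising_mu N t)"

end

theory Submission
  imports Defs
begin

text \<open>With \<open>f = \<nu>\<^sub>t / \<mu>\<^sub>t - 1\<close> and \<open>H' = H - \<mu>\<^sub>t(H)\<close> one has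
  \<open>\<epsilon>' = 2 M \<langle>f, L f\<rangle> + 2 \<langle>H' f\<rangle> \<epsilon> - \<langle>H' f\<^sup>2\<rangle>\<close>. The spectral gap of \<open>L\<close> is exponentially small at low
  temperature, but the gap of its restriction to either sign of the magnetization is at least \<open>1 / (9 N\<^sup>2)\<close>.
  Write \<open>f = c sgn + h\<close>, where \<open>h\<close> has mean zero on both halves. Since \<open>H\<close> is even, \<open>c\<close> enters the last
  two terms only through products with \<open>h\<close>, and the assumption on \<open>M\<close> yields
  \<open>\<epsilon>' \<le> \<epsilon> (1 + \<epsilon>) / (2 \<beta>)\<close>. Thus \<open>\<epsilon> / (1 + \<epsilon>)\<close> grows at most by the factor \<open>exp (1 / 2)\<close>.

  The local gap comes from a contraction argument: the restricted dynamics contracts a weighted Lipschitz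
  seminorm, with weights depending only on the magnetization and obtained from its birth-death chain.\<close>

text \<open>The obstacle is uniformity in the temperature, which enters the chain on one half as
  \<open>q = exp (- 4 * t / N)\<close> in \<open>(0, 1]\<close>. With equal weights on all levels
  the Lipschitz seminorm would contract at rate \<open>1 - slope\<close> above the lowest level, and
  this can be negative at low temperature; hence the weights adapted to the birth-death chain. The
  constants arise as follows. One half, run at rate one per proposed flip, has gap at least
  \<open>1 / (9 * N)\<close>, and the proposal probability \<open>1 / N\<close> supplies the second
  power of \<open>N\<close>. With \<open>v\<close> the squared norm of \<open>h\<close>, the
  threshold on \<open>M\<close> makes the dissipation at least
  \<open>(N / 2 + \<beta> * N^2 / 4) * v\<close>. The first summand pays for the fluctuation of
  \<open>H\<close> in the part quadratic in \<open>h\<close>, the second for the products of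
  \<open>h\<close> with \<open>c\<close> and with \<epsilon>. The propagator is given only as a
  solution of a linear equation. That it keeps measures nonnegative with positive mass, so that the
  normalisation makes sense, has to be proved as well.\<close>

section \<open>The birth-death chain of the magnetization\<close>

text \<open>\<open>slope n q i - 1\<close> is the increment from \<open>i\<close> to \<open>i + 1\<close> of the drift
  \<open>(n - i) - (n + 1 + i) q ^ i\<close>.\<close>

definition slope :: "nat \<Rightarrow> real \<Rightarrow> nat \<Rightarrow> real" where
  "slope n q i = q ^ i * ((real n + 2 + real i) * (1 - q) - 1)"

text \<open>An elementary substitute for \<open>(1 - p) ^ i \<le> exp (- i * p)\<close> combined
  with the quadratic Taylor bound of the exponential. The induction works because the one-step
  defect is the nonnegative \<open>p^2 / 2 + p * ((i + 1) * p)^2 / 2\<close>.\<close>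

lemma power_le_inverse_quadratic:
  fixes p :: real
  assumes "0 \<le> p" "p \<le> 1"
  shows "(1 - p) ^ i * (1 + real i * p + (real i * p)\<^sup>2 / 2) \<le> 1"
proof (induction i)
  case 0 then show ?case by simp
next
  case (Suc i)
  have "(1 - p) * (1 + real (Suc i) * p + (real (Suc i) * p)\<^sup>2 / 2)
      \<le> 1 + real i * p + (real i * p)\<^sup>2 / 2"
  proof -
    have "(1 + real i * p + (real i * p)\<^sup>2 / 2) - (1 - p) * (1 + real (Suc i) * p + (real (Suc i) * p)\<^sup>2 / 2)
       = p\<^sup>2 / 2 + p * (real (Suc i) * p)\<^sup>2 / 2"
      by (simp add: power2_eq_square field_simps)
    moreover have "p\<^sup>2 / 2 + p * (real (Suc i) * p)\<^sup>2 / 2 \<ge> 0" using assms by simp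
    ultimately show ?thesis by linarith
  qed
  then have "(1 - p) ^ i * ((1 - p) * (1 + real (Suc i) * p + (real (Suc i) * p)\<^sup>2 / 2))
      \<le> (1 - p) ^ i * (1 + real i * p + (real i * p)\<^sup>2 / 2)"
    using assms by (intro mult_left_mono) auto
  with Suc show ?case by (simp add: mult.assoc mult.left_commute)
qed

text \<open>If the bracket in \<open>slope\<close> is positive, then \<open>p = 1 - q\<close>
  exceeds \<open>1 / N\<close>. Flatness bounds the bracket by \<open>1 - p + i * p\<close> and the
  power is at most \<open>1 / (1 + i * p)\<close>; their product falls short of one by
  \<open>p / (1 + i * p)\<close>, which is at least \<open>p / 3\<close> because flatness also gives
  \<open>i * p < 2\<close>.\<close>

lemma slope_le_of_flat:
  assumes q: "0 < q" "q \<le> 1" and flat: "(1 - q) * (real n + 3) < 2" and i: "i < n"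
  shows "slope n q i \<le> 1 - 1 / (9 * real (2 * n + 1))"
proof -
  define p where "p = 1 - q"
  define N where "N = real (2 * n + 1)"
  have N: "N \<ge> 3" "N = 2 * real n + 1" using i by (auto simp: N_def)
  have p: "0 \<le> p" "p < 1" using q by (auto simp: p_def)
  have fl: "p * real n + 3 * p < 2" using flat by (simp add: p_def algebra_simps)
  have ii: "real i \<le> real n - 1" using i by linarith
  define c where "c = (real n + 2 + real i) * p - 1"
  have sl: "slope n q i = (1 - p) ^ i * c"
    by (simp add: slope_def p_def c_def)
  show ?thesis
  proof (cases "c \<le> 0")
    case True
    then have "slope n q i \<le> 0" unfolding sl using p by (simp add: mult_nonneg_nonpos)
    moreover have "1 / (9 * N) \<le> 1" using N by (simp add: divide_simps)
    ultimately show ?thesis unfolding N_def by linarith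
  next
    case False
    have "(2 * real n + 1) * p \<ge> (real n + 2 + real i) * p"
      using ii p by (intro mult_right_mono) auto
    then have pN: "N * p > 1" using False N by (simp add: c_def)
    have ip: "real i * p \<le> p * real n" using ii p by (simp add: mult.commute mult_left_mono)
    then have ip2: "real i * p < 2" using fl p by linarith
    have c: "c \<le> 1 - p + real i * p" using fl by (simp add: c_def algebra_simps)
    have pw: "(1 - p) ^ i * (1 + real i * p) \<le> 1"
    proof -
      have "(1 - p) ^ i * (1 + real i * p) \<le> (1 - p) ^ i * (1 + real i * p + (real i * p)\<^sup>2 / 2)"
        using p by (intro mult_left_mono) auto
      with power_le_inverse_quadratic[of p i] p show ?thesis by linarith
    qed
    have pos: "0 < 1 + real i * p" using p by (smt (verit) mult_nonneg_nonneg of_nat_0_le_iff)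
    have "(1 - p) ^ i \<le> 1 / (1 + real i * p)" using pw pos by (simp add: pos_le_divide_eq)
    then have "slope n q i \<le> 1 / (1 + real i * p) * (1 - p + real i * p)"
      unfolding sl using c False p by (intro mult_mono) auto
    also have "\<dots> = 1 - p / (1 + real i * p)" using pos by (simp add: field_simps)
    also have "\<dots> \<le> 1 - p / 3"
      using p ip2 pos by (intro diff_left_mono divide_left_mono) auto
    finally have *: "slope n q i \<le> 1 - p / 3" .
    have "p / 3 \<ge> 1 / (9 * N)"
    proof -
      have "1 / (9 * N) \<le> (N * p) / (9 * N)" using pN N by (intro divide_right_mono) auto
      also have "\<dots> = p / 9" using N(1) by simp
      finally show ?thesis using p by linarith
    qed
    with * show ?thesis unfolding N_def by linarith
  qed
qed

text \<open>The difference of consecutive slopes has the sign of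
  \<open>2 - (1 - q) * (n + 3 + i)\<close>, so the hypothesis is the condition at
  \<open>i = 0\<close>. In the steep regime the levels with too large a slope therefore form an
  initial segment.\<close>

lemma slope_antimono_of_steep:
  assumes q: "0 < q" "q \<le> 1" and steep: "(1 - q) * (real n + 3) \<ge> 2"
  shows "slope n q (Suc i) \<le> slope n q i"
proof -
  have "slope n q (Suc i) - slope n q i = q ^ i * ((1 - q) * (2 - (1 - q) * (real n + 3 + real i)))"
    unfolding slope_def by (simp add: algebra_simps)
  moreover have "(1 - q) * (real n + 3 + real i) \<ge> 2" 
    using steep q mult_nonneg_nonneg[of "1-q" "real i"] by (simp add: algebra_simps)
  ultimately show ?thesis using q
    by (smt (verit) mult_nonneg_nonpos zero_le_power)
qed

text \<open>Used contrapositively: a level whose slope is still too large lies below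
  \<open>4 * n / 5\<close>, so its birth rate \<open>n - k\<close> exceeds
  \<open>n / 5\<close>.\<close>

lemma slope_le_of_late:
  assumes q: "0 < q" "q \<le> 1" and k: "k < n" and late: "4 * real n \<le> 5 * real k"
  shows "slope n q k \<le> 1 - 1 / (9 * real (2 * n + 1))"
proof -
  define p where "p = 1 - q"
  define N where "N = real (2 * n + 1)"
  define s where "s = real k * p"
  have p: "0 \<le> p" "p < 1" using q by (auto simp: p_def)
  have "real n \<ge> real k + 1" using k by linarith
  then have k4: "real k \<ge> 4" using late by linarith
  have N: "N \<ge> 9" using k k4 by (auto simp: N_def)
  have s: "s \<ge> 4 * p" unfolding s_def using k4 p by (intro mult_right_mono) auto
  have "real n * p \<le> (5 / 4 * real k) * p" using late p by (intro mult_right_mono) auto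
  then have "(real n + 2 + real k) * p - 1 \<le> 9 / 4 * s + 2 * p - 1"
    by (simp add: s_def algebra_simps)
  then have c: "(real n + 2 + real k) * p - 1 \<le> 11 / 4 * s - 1" using s by linarith
  define \<delta> where "\<delta> = 1 / (9 * N)"
  have \<delta>: "\<delta> \<le> 1 / 81" "\<delta> \<ge> 0" using N by (auto simp: \<delta>_def divide_simps)
  have s0: "s \<ge> 0" using s p by linarith
  \<comment> \<open>A line against a parabola. The point \<open>9 / 5\<close> is close to the
    minimiser of the difference, and \<open>\<delta> \<le> 1 / 81\<close> leaves enough room
    there.\<close>
  have key: "11 / 4 * s - 1 \<le> (1 - \<delta>) * (1 + s + s\<^sup>2 / 2)"
  proof -
    have "\<delta> * (1 + s + s\<^sup>2 / 2) \<le> 1 / 81 * (1 + s + s\<^sup>2 / 2)"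
      using \<delta> s0 by (intro mult_right_mono) auto
    moreover have "0 \<le> (s - 9 / 5)\<^sup>2" by simp
    moreover have "(s - 9 / 5)\<^sup>2 = s\<^sup>2 - 18 / 5 * s + 81 / 25"
      by (simp add: power2_eq_square field_simps)
    ultimately show ?thesis using s0 unfolding left_diff_distrib by argo
  qed
  have "slope n q k = (1 - p) ^ k * ((real n + 2 + real k) * p - 1)"
    by (simp add: slope_def p_def)
  also have "\<dots> \<le> (1 - p) ^ k * ((1 - \<delta>) * (1 + s + s\<^sup>2 / 2))"
    using c key p by (intro mult_left_mono) auto
  also have "\<dots> = (1 - \<delta>) * ((1 - p) ^ k * (1 + s + s\<^sup>2 / 2))" by simp
  also have "\<dots> \<le> (1 - \<delta>) * 1"
    using \<delta> p power_le_inverse_quadratic[of p k] unfolding s_def by (intro mult_left_mono) auto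
  finally show ?thesis by (simp add: \<delta>_def N_def)
qed

text \<open>From \<open>I\<close> on the increments change sign at most once, from plus to minus. As
  long as they are nonnegative the sums grow from \<open>R I\<close>; afterwards they decrease to
  the final value \<open>0\<close>.\<close>

lemma partial_sums_nonneg:
  fixes R :: "nat \<Rightarrow> real"
  assumes I: "I \<le> n" "R I \<ge> 0" and end0: "R (Suc n) = 0"
    and step: "\<And>k. k \<le> n \<Longrightarrow> R (Suc k) = R k + w k * \<psi> k"
    and w: "\<And>k. k \<le> n \<Longrightarrow> w k > 0"
    and dec: "\<And>k. I \<le> k \<Longrightarrow> k < n \<Longrightarrow> \<psi> (Suc k) \<le> \<psi> k"
    and k: "I \<le> k" "k \<le> n"
  shows "R (Suc k) \<ge> 0"
proof -
  have anti: "\<psi> j \<le> \<psi> i" if "I \<le> i" "i \<le> j" "j \<le> n" for i j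
    using that(2,3)
  proof (induction j rule: dec_induct)
    case base then show ?case by simp
  next
    case (step m) then show ?case using dec[of m] that(1) by simp
  qed
  show ?thesis
  proof (cases "\<psi> k \<ge> 0")
    case True
    have "j \<le> Suc k \<Longrightarrow> R j \<ge> 0" if "I \<le> j" for j
      using that
    proof (induction j rule: dec_induct)
      case base then show ?case using I by simp
    next
      case (step m)
      then have "\<psi> m \<ge> 0" using anti[of m k] True k by simp
      then have "w m * \<psi> m \<ge> 0" using w[of m] step k by simp
      then show ?case using step assms(4)[of m] k by simp
    qed
    from this[of "Suc k"] k show ?thesis by simp
  next
    case False
    have "j \<le> Suc n \<Longrightarrow> R (Suc n) \<le> R j" if "Suc k \<le> j" for j
      using that
    proof (induction "Suc n - j" arbitrary: j)
      case 0 then have "j = Suc n" by simp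
      then show ?case by simp
    next
      case (Suc x)
      then have j: "j \<le> n" by simp
      have "R (Suc n) \<le> R (Suc j)" using Suc j by simp
      moreover have "\<psi> j \<le> \<psi> k" using anti[of k j] Suc.prems j k by simp
      then have "w j * \<psi> j \<le> 0" using w[OF j] False by (simp add: mult_nonneg_nonpos)
      ultimately show ?case using step[OF j] by simp
    qed
    from this[of "Suc k"] k end0 show ?thesis by simp
  qed
qed

lemma sum_consecutive_products:
  "k \<le> n \<Longrightarrow> (\<Sum>j<k. (real n - real j) * (real n - real j + 1)) * 3
    = real n * (real n + 1) * (real n + 2)
      - (real n - real k) * (real n - real k + 1) * (real n - real k + 2)"
proof (induction k)
  case 0 then show ?case by simp
next
  case (Suc k)
  then show ?case by (simp add: algebra_simps)
qed

text \<open>\<open>d\<close> is the gradient of the solution of the Poisson equation \<open>L g = mean - id\<close> for the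
  birth-death chain on \<open>{0..n}\<close> with birth rates \<open>b\<close>, death rates \<open>a\<close> and stationary weights \<open>w\<close>,
  that is \<open>d k = A (k + 1) / Q k\<close> with the flux \<open>Q k = w k * b k\<close>. Since \<open>Q\<close> is the partial sum of
  \<open>w * (b - a)\<close>, the bound on \<open>d\<close> says that the partial sums \<open>R\<close> of \<open>w * \<psi>\<close> are nonnegative.
  From the index \<open>I\<close> on, \<open>\<psi>\<close> is decreasing; before it, \<open>b - a\<close> is bounded below and \<open>Q\<close> is almost
  increasing.\<close>

lemma birth_death_metric:
  fixes q :: real
  assumes n: "n > 0" and q: "0 < q" "q \<le> 1"
  defines "N \<equiv> real (2 * n + 1)"
  defines "a \<equiv> \<lambda>i. if i = 0 then 0 else (real n + 1 + real i) * q ^ i"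
    and "b \<equiv> \<lambda>i. real n - real i"
  obtains d :: "nat \<Rightarrow> real" where
    "\<And>i. i < n \<Longrightarrow> 0 < d i" "\<And>i. i < n \<Longrightarrow> d i \<le> 9 * N" "d 0 \<le> 1"
    "\<And>i. i < n \<Longrightarrow> (a (Suc i) + b i) * d i - a i * d (i - 1) - b (Suc i) * d (Suc i) = 1"
proof -
  have N: "N \<ge> 3" "N = 2 * real n + 1" using n by (auto simp: N_def)
  have apos: "a (Suc i) > 0" for i using q by (simp add: a_def add_pos_nonneg)
  have bpos: "b i > 0" if "i < n" for i using that by (simp add: b_def)
  \<comment> \<open>Detailed balance \<open>w (i + 1) * a (i + 1) = w i * b i\<close>, normalised at
    the lowest level.\<close>
  define w where "w = rec_nat 1 (\<lambda>i x. x * b i / a (Suc i))"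
  have w0: "w 0 = 1" and wS: "w (Suc i) = w i * b i / a (Suc i)" for i
    by (auto simp: w_def)
  have wpos: "w i > 0" if "i \<le> n" for i
    using that
  proof (induction i)
    case 0 then show ?case by (simp add: w0)
  next
    case (Suc i) then show ?case using apos bpos[of i] by (simp add: wS)
  qed
  define Z where "Z = (\<Sum>i\<le>n. w i)"
  define m where "m = (\<Sum>i\<le>n. real i * w i) / Z"
  have Z: "Z > 0" unfolding Z_def using wpos by (intro sum_pos) auto
  have mn: "m \<le> n" 
  proof -
    have "(\<Sum>i\<le>n. real i * w i) \<le> (\<Sum>i\<le>n. real n * w i)"
      using wpos by (intro sum_mono mult_right_mono) (auto simp: less_imp_le)
    then show ?thesis unfolding m_def using Z by (simp add: divide_le_eq sum_distrib_left Z_def)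
  qed
  have m0: "m > 0"
  proof -
    have "(\<Sum>i\<le>n. real i * w i) > 0"
      using n wpos by (intro sum_pos2[of _ n]) (auto simp: less_imp_le)
    then show ?thesis using Z by (simp add: m_def)
  qed
  define A where "A k = (\<Sum>j<k. w j * (m - real j))" for k
  have AS: "A (Suc k) = A k + w k * (m - real k)" for k by (simp add: A_def)
  have Aend: "A (Suc n) = 0"
  proof -
    have "A (Suc n) = (\<Sum>j\<le>n. w j * m - real j * w j)"
      unfolding A_def lessThan_Suc_atMost by (intro sum.cong) (auto simp: algebra_simps)
    also have "\<dots> = Z * m - (\<Sum>j\<le>n. real j * w j)"
      by (simp add: sum_subtractf sum_distrib_right Z_def)
    also have "\<dots> = 0" using Z by (simp add: m_def)
    finally show ?thesis .
  qed
  \<comment> \<open>The summands \<open>w j * (m - j)\<close> change sign once and add up to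
    zero.\<close>
  have Apos: "A (Suc k) > 0" if "k < n" for k
  proof (cases "real k < m")
    case True
    have "A (Suc k) \<ge> w 0 * (m - real 0)" unfolding A_def
      using True wpos that by (intro member_le_sum) (auto simp: less_imp_le)
    then show ?thesis using m0 by (simp add: w0)
  next
    case False
    have "A (Suc n) = A (Suc k) + (\<Sum>j=Suc k..<Suc n. w j * (m - real j))"
      unfolding A_def lessThan_atLeast0 by (rule sum.atLeastLessThan_concat[symmetric]) (use that in auto)
    moreover have "(\<Sum>j=Suc k..<Suc n. w j * (real j - m)) > 0"
      using False wpos that by (intro sum_pos) auto
    then have "(\<Sum>j=Suc k..<Suc n. w j * (m - real j)) < 0"
      by (simp add: right_diff_distrib sum_subtractf)
    ultimately show ?thesis using Aend by simp
  qed
  define Q where "Q k = w k * b k" for k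
  have Qpos: "Q k > 0" if "k < n" for k using that wpos[of k] bpos by (simp add: Q_def)
  have Qw: "Q k = w (Suc k) * a (Suc k)" for k using apos[of k] by (simp add: Q_def wS)
  define d where "d k = A (Suc k) / Q k" for k
  have balance: "(a (Suc i) + b i) * d i - a i * d (i - 1) - b (Suc i) * d (Suc i) = 1"
    if "i < n" for i
  proof -
    have wi: "w i > 0" "w (Suc i) > 0" using wpos that by auto
    have 1: "a (Suc i) * d i = A (Suc i) / w (Suc i)"
      using apos[of i] by (simp add: d_def Qw)
    have 2: "b i * d i = A (Suc i) / w i"
      using bpos[OF that] by (simp add: d_def Q_def)
    \<comment> \<open>The factor \<open>a 0 = 0\<close> makes the truncated index
      \<open>0 - 1\<close> harmless; in the same way \<open>b n = 0\<close> hides the value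
      \<open>d n\<close> at the upper end.\<close>
    have 3: "a i * d (i - 1) = A i / w i"
    proof (cases i)
      case 0 then show ?thesis by (simp add: a_def A_def)
    next
      case (Suc j) then show ?thesis using apos[of j] by (simp add: d_def Qw)
    qed
    have 4: "b (Suc i) * d (Suc i) = A (Suc (Suc i)) / w (Suc i)"
    proof (cases "Suc i < n")
      case True then show ?thesis using bpos[OF True] by (simp add: d_def Q_def)
    next
      case False then have "Suc i = n" using that by simp
      then show ?thesis using Aend by (simp add: b_def)
    qed
    have "(a (Suc i) + b i) * d i - a i * d (i - 1) - b (Suc i) * d (Suc i)
       = (A (Suc i) - A (Suc (Suc i))) / w (Suc i) + (A (Suc i) - A i) / w i"
      using 1 2 3 4 by (simp add: distrib_right diff_divide_distrib)
    also have "\<dots> = 1" using wi AS[of i] AS[of "Suc i"] by simp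
    finally show ?thesis .
  qed
  have d0: "d 0 \<le> 1" using mn n by (simp add: d_def A_def Q_def w0 b_def)
  define v where "v i = b i - a i" for i
  \<comment> \<open>The drift formula continued to level \<open>0\<close>, where it gives
    \<open>-1\<close>. The true drift there is \<open>n\<close>, since the move down is blocked, and
    the recursion through \<open>slope\<close> is valid from level \<open>0\<close> only for
    \<open>vx\<close>.\<close>
  define vx where "vx i = real n - real i - (real n + 1 + real i) * q ^ i" for i
  have v_vx: "v i = vx i" if "i > 0" for i using that by (simp add: v_def vx_def a_def b_def)
  have vx_v: "vx i \<le> v i" for i by (cases "i = 0") (auto simp: v_def vx_def a_def b_def)
  have vxS: "vx (Suc i) = vx i - 1 + slope n q i" for i
    by (simp add: vx_def slope_def algebra_simps)
  define \<psi> where "\<psi> i = 9 * N * v i + real i - m" for i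
  define R where "R k = (\<Sum>j<k. w j * \<psi> j)" for k
  have Qsum: "Q k = (\<Sum>j\<le>k. w j * v j)" for k
  proof (induction k)
    case 0 then show ?case by (simp add: Q_def v_def a_def)
  next
    case (Suc k)
    then show ?case using Qw[of k] by (simp add: v_def Q_def algebra_simps)
  qed
  have R: "R (Suc k) = 9 * N * Q k - A (Suc k)" for k
  proof -
    have "R (Suc k) = (\<Sum>j\<le>k. 9 * N * (w j * v j) - w j * (m - real j))"
      unfolding R_def lessThan_Suc_atMost \<psi>_def by (intro sum.cong) (auto simp: algebra_simps)
    then show ?thesis
      by (simp add: sum_subtractf sum_distrib_left[symmetric] Qsum A_def lessThan_Suc_atMost)
  qed
  \<comment> \<open>A slope of at most \<gamma> makes \<open>9 * N * v\<close> drop by at least one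
    per level, which offsets the growth of the summand \<open>real i\<close> in \<psi>.\<close>
  define \<gamma> where "\<gamma> = 1 - 1 / (9 * N)"
  have "\<exists>I\<le>n. (\<forall>i. I \<le> i \<and> i < n \<longrightarrow> slope n q i \<le> \<gamma>) \<and> (\<forall>i<I. slope n q i > \<gamma>)"
  proof (cases "(1 - q) * (real n + 3) < 2")
    case True
    then show ?thesis
      using slope_le_of_flat[OF q True] unfolding \<gamma>_def N_def by (intro exI[of _ 0]) auto
  next
    case False
    have anti: "slope n q j \<le> slope n q i" if "i \<le> j" for i j
      using that
    proof (induction rule: dec_induct)
      case base show ?case by simp
    next
      case (step m)
      have "slope n q (Suc m) \<le> slope n q m" using slope_antimono_of_steep[OF q] False by simp
      then show ?case using step by linarith
    qed
    define I where "I = (LEAST i. i = n \<or> slope n q i \<le> \<gamma>)"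
    have I: "I = n \<or> slope n q I \<le> \<gamma>" unfolding I_def by (rule LeastI[of _ n]) simp
    have le: "I \<le> n" unfolding I_def by (rule Least_le) simp
    have "slope n q i > \<gamma>" if "i < I" for i
      using not_less_Least[of i "\<lambda>i. i = n \<or> slope n q i \<le> \<gamma>"] that
      unfolding I_def[symmetric] by simp
    moreover have "slope n q i \<le> \<gamma>" if "I \<le> i" "i < n" for i
      using I anti[OF that(1)] that by auto
    ultimately show ?thesis using le by blast
  qed
  then obtain I where I: "I \<le> n" "\<And>i. I \<le> i \<Longrightarrow> i < n \<Longrightarrow> slope n q i \<le> \<gamma>"
    "\<And>i. i < I \<Longrightarrow> slope n q i > \<gamma>" by blast
  have early: "A (Suc k) \<le> 9 * N * Q k" if "k < I" for k
  proof -
    have kn: "k < n" using that I by simp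
    \<comment> \<open>Below \<open>I\<close> each step lowers \<open>vx\<close> by less than
      \<open>1 / (9 * N)\<close>, starting from \<open>-1\<close>. Over fewer than \<open>n\<close>
      steps the death rate thus exceeds the birth rate by at most two.\<close>
    have vlow: "vx i \<ge> - 1 - real i / (9 * N)" if "i \<le> k" for i
      using that
    proof (induction i)
      case 0 then show ?case by (simp add: vx_def)
    next
      case (Suc i)
      then show ?case using vxS[of i] I(3)[of i] \<open>k < I\<close>
        by (simp add: \<gamma>_def add_divide_distrib)
    qed
    have vlow2: "a i \<le> b i + 2" if "i \<le> k" for i
    proof -
      have "real i / (9 * N) \<le> 1" using that kn N by (simp add: divide_simps)
      then show ?thesis using vlow[OF that] vx_v[of i] by (simp add: v_def)
    qed
    \<comment> \<open>One has \<open>Q i / Q (i + 1) = a (i + 1) / b (i + 1) \<le> (b (i + 1) + 2) /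
      b (i + 1)\<close>. As \<open>b i = b (i + 1) + 1\<close>, the last quotient is exactly that of
      \<open>b * (b + 1)\<close> at \<open>i\<close> and \<open>i + 1\<close>, so dividing
      \<open>Q\<close> by \<open>b * (b + 1)\<close> makes it increasing.\<close>
    define u where "u i = Q i / (b i * (b i + 1))" for i
    have umono: "u i \<le> u (Suc i)" if "Suc i \<le> k" for i
    proof -
      have bS: "b i = b (Suc i) + 1" by (simp add: b_def)
      have bp: "b (Suc i) > 0" using that kn bpos by simp
      have wp: "w (Suc i) > 0" using wpos that kn by simp
      have "u i = w (Suc i) * a (Suc i) / ((b (Suc i) + 1) * (b (Suc i) + 2))"
        by (simp add: u_def Qw bS add.commute)
      also have "\<dots> \<le> w (Suc i) * (b (Suc i) + 2) / ((b (Suc i) + 1) * (b (Suc i) + 2))"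
        using vlow2[OF that] wp bp by (intro divide_right_mono mult_left_mono) auto
      also have "\<dots> = u (Suc i)" using bp by (simp add: u_def Q_def)
      finally show ?thesis .
    qed
    have uk: "u j \<le> u k" if "j \<le> k" for j
      using that
    proof (induction rule: inc_induct)
      case base show ?case by simp
    next
      case (step m) then show ?case using umono[of m] by linarith
    qed
    have bk: "b k > 0" using bpos kn by simp
    \<comment> \<open>The mean satisfies \<open>m \<le> n\<close>, hence
      \<open>m - j \<le> b j\<close>.\<close>
    have "A (Suc k) \<le> (\<Sum>j<Suc k. Q j)"
      unfolding A_def Q_def b_def using mn wpos kn
      by (intro sum_mono mult_left_mono) (auto simp: less_imp_le)
    also have "\<dots> = (\<Sum>j<Suc k. u j * (b j * (b j + 1)))"
    proof (rule sum.cong)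
      fix j assume "j \<in> {..<Suc k}"
      then have "b j > 0" using bpos kn by simp
      then show "Q j = u j * (b j * (b j + 1))" by (simp add: u_def)
    qed simp
    also have "\<dots> \<le> (\<Sum>j<Suc k. u k * (b j * (b j + 1)))"
      using uk kn bpos by (intro sum_mono mult_right_mono) (auto simp: less_imp_le)
    also have "\<dots> = u k * (\<Sum>j<Suc k. b j * (b j + 1))" by (rule sum_distrib_left[symmetric])
    also have "\<dots> \<le> u k * (9 * N * (b k * (b k + 1)))"
    proof (rule mult_left_mono)
      show "0 \<le> u k" using Qpos[OF kn] bk by (simp add: u_def)
      have 0: "b (Suc k) \<ge> 0" using kn by (simp add: b_def)
      have sm: "(\<Sum>j<Suc k. b j * (b j + 1)) * 3 \<le> real n * (real n + 1) * (real n + 2)"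
        using sum_consecutive_products[of "Suc k" n] kn 0 unfolding b_def by simp
      \<comment> \<open>The telescoped sum is of order \<open>n^3\<close>, to be dominated by a
        multiple of \<open>N * (b k)^2\<close>. This requires \<open>b k\<close> to be of order
        \<open>n\<close>, which holds because \<open>k\<close> lies before \<open>I\<close>.\<close>
      have "\<not> 4 * real n \<le> 5 * real k"
        using slope_le_of_late[OF q kn] I(3)[OF that] unfolding \<gamma>_def N_def by linarith
      then have bn: "b k \<ge> real n / 5" by (simp add: b_def)
      have "real n * (real n + 1) * (real n + 2) \<le> 27 * N * (real n / 5 * (real n / 5 + 1))"
      proof -
        have "27 * N * (real n / 5 * (real n / 5 + 1)) - real n * (real n + 1) * (real n + 2)
          = real n * ((29 * (real n)\<^sup>2 + 222 * real n + 85) / 25)"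
          unfolding N(2) by (simp add: field_simps power2_eq_square)
        moreover have "\<dots> \<ge> 0" by simp
        ultimately show ?thesis by linarith
      qed
      also have "\<dots> \<le> 27 * N * (b k * (b k + 1))"
        using bn N bk by (intro mult_left_mono mult_mono) auto
      finally show "(\<Sum>j<Suc k. b j * (b j + 1)) \<le> 9 * N * (b k * (b k + 1))" using sm by linarith
    qed
    also have "\<dots> = 9 * N * Q k" using bk by (simp add: u_def)
    finally show ?thesis .
  qed
  have RI: "R I \<ge> 0"
  proof (cases I)
    case 0 then show ?thesis by (simp add: R_def)
  next
    case (Suc k) then show ?thesis using early[of k] R[of k] by simp
  qed
  have Rpos: "R (Suc k) \<ge> 0" if "k < n" for k
  proof (cases "k < I")
    case True then show ?thesis using early R[of k] by simp
  next
    case False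
    show ?thesis
    proof (rule partial_sums_nonneg[of I n R w \<psi>])
      show "R (Suc n) = 0" using R[of n] Aend by (simp add: Q_def b_def)
      fix k assume k: "I \<le> k" "k < n"
      have "vx (Suc k) \<le> v k - 1 / (9 * N)" using vxS[of k] I(2)[OF k] vx_v[of k] by (simp add: \<gamma>_def)
      then have "9 * N * v (Suc k) \<le> 9 * N * (v k - 1 / (9 * N))"
        using N v_vx[of "Suc k"] by (intro mult_left_mono) auto
      also have "\<dots> = 9 * N * v k - 1" using N by (simp add: right_diff_distrib)
      finally show "\<psi> (Suc k) \<le> \<psi> k" by (simp add: \<psi>_def)
    qed (use I RI wpos False that in \<open>auto simp: R_def\<close>)
  qed
  have "d k \<le> 9 * N" if "k < n" for k
    using Qpos[OF that] R[of k] Rpos[OF that] by (simp add: d_def divide_le_eq)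
  moreover have "d k > 0" if "k < n" for k using Apos Qpos that by (simp add: d_def)
  ultimately show ?thesis using d0 balance that by blast
qed

section \<open>The local Poincare inequality\<close>

text \<open>By Cauchy-Schwarz \<open>\<langle>f, T ^ (2 k) f\<rangle> \<ge> \<langle>f, T ^ k f\<rangle>\<^sup>2 / \<langle>f, f\<rangle>\<close>; a Rayleigh quotient above \<open>\<rho>\<close>
  would thus contradict the decay along powers of two.\<close>

lemma self_adjoint_rayleigh_le:
  fixes w f :: "'a \<Rightarrow> real" and T :: "('a \<Rightarrow> real) \<Rightarrow> 'a \<Rightarrow> real"
  assumes w: "\<And>x. x \<in> X \<Longrightarrow> w x \<ge> 0"
    and sym: "\<And>g h. (\<Sum>x\<in>X. w x * g x * T h x) = (\<Sum>x\<in>X. w x * T g x * h x)"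
    and decay: "\<And>k. (\<Sum>x\<in>X. w x * f x * (T ^^ k) f x) \<le> K * \<rho> ^ k"
    and \<rho>: "\<rho> > 0"
  shows "(\<Sum>x\<in>X. w x * f x * T f x) \<le> \<rho> * (\<Sum>x\<in>X. w x * f x * f x)"
proof -
  define ip where "ip g h = (\<Sum>x\<in>X. w x * g x * h x)" for g h
  have sym': "ip g (T h) = ip (T g) h" for g h using sym by (simp add: ip_def)
  have cs: "(ip g h)\<^sup>2 \<le> ip g g * ip h h" for g h
  proof -
    have "(\<Sum>x\<in>X. (sqrt (w x) * g x) * (sqrt (w x) * h x))\<^sup>2
      \<le> (\<Sum>x\<in>X. (sqrt (w x) * g x)\<^sup>2) * (\<Sum>x\<in>X. (sqrt (w x) * h x)\<^sup>2)"
      by (rule Cauchy_Schwarz_ineq_sum)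
    moreover have "(\<Sum>x\<in>X. (sqrt (w x) * g x) * (sqrt (w x) * h x)) = ip g h" for g h
      unfolding ip_def
    proof (rule sum.cong)
      fix x assume "x \<in> X"
      then have "sqrt (w x) * sqrt (w x) = w x" using w by simp
      then show "(sqrt (w x) * g x) * (sqrt (w x) * h x) = w x * g x * h x"
        by (metis mult.assoc mult.left_commute)
    qed simp
    ultimately show ?thesis by (simp add: power2_eq_square)
  qed
  have shift: "ip g ((T ^^ k) h) = ip ((T ^^ k) g) h" for g h k
  proof (induction k arbitrary: g)
    case 0 then show ?case by simp
  next
    case (Suc k)
    have "ip g ((T ^^ Suc k) h) = ip (T g) ((T ^^ k) h)" by (simp add: sym')
    also have "\<dots> = ip ((T ^^ Suc k) g) h" by (simp only: Suc funpow_Suc_right o_apply)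
    finally show ?case .
  qed
  have F: "ip f f \<ge> 0" unfolding ip_def using w by (intro sum_nonneg) (simp add: mult.assoc)
  show ?thesis
  proof (cases "ip f f = 0")
    case True
    then have "ip f (T f) = 0" using cs[of f "T f"] by simp
    then show ?thesis using True by (simp add: ip_def)
  next
    case False
    then have F: "ip f f > 0" using F by simp
    define r where "r = ip f (T f) / ip f f"
    show ?thesis
    proof (rule ccontr)
      assume "\<not> ?thesis"
      then have "ip f (T f) > \<rho> * ip f f" by (simp add: ip_def)
      then have r: "r > \<rho>" using F by (simp add: r_def less_divide_eq)
      have low: "ip f f * r ^ (2 ^ m) \<le> ip f ((T ^^ (2 ^ m)) f)" for m
      proof (induction m)
        case 0 then show ?case using F by (simp add: r_def)
      next
        case (Suc m)
        let ?g = "(T ^^ (2 ^ m)) f"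
        have "(T ^^ (2 ^ Suc m)) f = (T ^^ (2 ^ m)) ?g"
          by (simp add: funpow_add mult_2)
        then have 1: "ip f ((T ^^ (2 ^ Suc m)) f) = ip ?g ?g" by (simp add: shift)
        have "(ip f f * r ^ (2 ^ m))\<^sup>2 \<le> (ip f ?g)\<^sup>2"
          using Suc F r \<rho> by (intro power_mono) auto
        also have "\<dots> \<le> ip f f * ip ?g ?g" by (rule cs)
        finally have "ip f f * (ip f f * r ^ (2 ^ Suc m)) \<le> ip f f * ip ?g ?g"
          by (simp add: power2_eq_square mult_2 power_add mult.assoc mult.left_commute)
        then show ?case using F 1 by (simp only: mult_le_cancel_left_pos)
      qed
      have bd: "(r / \<rho>) ^ m \<le> K / ip f f" for m
      proof -
        have "(r / \<rho>) ^ m \<le> (r / \<rho>) ^ (2 ^ m)"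
          using r \<rho> by (intro power_increasing) (auto simp: less_imp_le)
        also have "\<dots> \<le> K / ip f f"
        proof -
          have "ip f f * r ^ (2 ^ m) \<le> K * \<rho> ^ (2 ^ m)"
            using low[of m] decay[of "2 ^ m"] by (simp only: ip_def)
          then show ?thesis using F \<rho> by (simp add: power_divide divide_simps mult.commute)
        qed
        finally show ?thesis .
      qed
      have "r / \<rho> > 1" using r \<rho> by simp
      then obtain m where "(r / \<rho>) ^ m > K / ip f f" using real_arch_pow by blast
      with bd[of m] show False by simp
    qed
  qed
qed

text \<open>An Euler step for a difference \<open>D\<close> with loss rate \<open>x\<close> and gain
  \<open>E\<close>. The condition \<open>c * x \<le> 1\<close> keeps the coefficient of the old
  difference nonnegative.\<close>

lemma convex_step_bound:
  fixes D E K L c x :: real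
  assumes "0 \<le> c" "c * x \<le> 1" "\<bar>D\<bar> \<le> K" "\<bar>E\<bar> \<le> L"
  shows "\<bar>D + c * (E - x * D)\<bar> \<le> (1 - c * x) * K + c * L"
proof -
  have "D + c * (E - x * D) = (1 - c * x) * D + c * E" by (simp add: algebra_simps)
  also have "\<bar>\<dots>\<bar> \<le> \<bar>(1 - c * x) * D\<bar> + \<bar>c * E\<bar>" by (rule abs_triangle_ineq)
  also have "\<dots> \<le> (1 - c * x) * K + c * L"
    unfolding abs_mult using assms by (intro add_mono mult_mono) auto
  finally show ?thesis .
qed

lemma abs_sum_le: "(\<And>j. j \<in> J \<Longrightarrow> \<bar>g j\<bar> \<le> K) \<Longrightarrow> \<bar>sum g J\<bar> \<le> real (card J) * (K::real)"
  using sum_norm_bound[of J g K] by simp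

text \<open>A configuration with positive magnetization is identified with its set of plus spins, a subset of
  \<open>U\<close> of more than half the size, and weighted by \<open>W\<close>. \<open>G\<close> is the Metropolis generator with moves
  out of this half suppressed, sped up by the factor \<open>card U\<close>.\<close>

locale half_cube =
  fixes U :: "'a set" and n :: nat and q :: real and W :: "nat \<Rightarrow> real"
  assumes finU: "finite U" and cardU: "card U = 2 * n + 1"
    and q: "0 < q" "q \<le> 1"
    and Wpos: "\<And>k. W k > 0"
    and Wratio: "\<And>i. W (n + 1 + i) = W (n + 2 + i) * q ^ (i + 1)"
begin

definition X :: "'a set set" where "X = {A. A \<subseteq> U \<and> n < card A}"

definition lev :: "'a set \<Rightarrow> nat" where "lev A = card A - (n + 1)"

definition R :: "'a set \<Rightarrow> real" where "R A = (if lev A = 0 then 0 else q ^ lev A)"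

definition G :: "('a set \<Rightarrow> real) \<Rightarrow> 'a set \<Rightarrow> real" where
  "G f A = (\<Sum>i\<in>U - A. f (insert i A) - f A) + R A * (\<Sum>i\<in>A. f (A - {i}) - f A)"

section \<open>Moves and reversibility on half of the cube\<close>

lemma finX: "finite X" using finU by (auto simp: X_def)

lemma X_D: "A \<in> X \<Longrightarrow> A \<subseteq> U" "A \<in> X \<Longrightarrow> finite A" "A \<in> X \<Longrightarrow> card A = n + 1 + lev A"
  using finU finite_subset by (auto simp: X_def lev_def)

lemma insert_X:
  assumes "A \<in> X" "i \<in> U - A"
  shows "insert i A \<in> X" "lev (insert i A) = Suc (lev A)"
  using assms X_D(1,2)[OF assms(1)] by (auto simp: X_def lev_def)

lemma remove_X:
  assumes "A \<in> X" "i \<in> A" "lev A \<noteq> 0"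
  shows "A - {i} \<in> X" "lev (A - {i}) = lev A - 1"
  using assms X_D(1,2)[OF assms(1)] by (auto simp: X_def lev_def)

lemma swap_X:
  assumes "A \<in> X" "i \<in> U - A" "j \<in> A"
  shows "insert i (A - {j}) \<in> X" "lev (insert i (A - {j})) = lev A" "R (insert i (A - {j})) = R A"
proof -
  have "card (insert i (A - {j})) = card A"
    using assms X_D[OF assms(1)] by (simp add: card_Suc_Diff1)
  then show "insert i (A - {j}) \<in> X" "lev (insert i (A - {j})) = lev A"
    "R (insert i (A - {j})) = R A"
    using assms X_D(1,2)[OF assms(1)] by (auto simp: X_def lev_def R_def)
qed

text \<open>Detailed balance in summed form: every move down is matched with the move up that
  reverses it. The vanishing of \<open>R\<close> on the lowest level removes exactly the moves that
  would leave \<open>X\<close>.\<close>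

lemma down_sum:
  "(\<Sum>B\<in>X. \<Sum>i\<in>B. W (card B) * R B * h B (B - {i}))
     = (\<Sum>A\<in>X. \<Sum>i\<in>U - A. W (card A) * h (insert i A) A)"
proof -
  define Y where "Y = {B \<in> X. lev B \<noteq> 0}"
  have "(\<Sum>B\<in>X. \<Sum>i\<in>B. W (card B) * R B * h B (B - {i}))
      = (\<Sum>B\<in>Y. \<Sum>i\<in>B. W (card B) * R B * h B (B - {i}))"
    by (rule sum.mono_neutral_right) (use finX in \<open>auto simp: Y_def R_def\<close>)
  also have "\<dots> = (\<Sum>(B,i)\<in>Sigma Y (\<lambda>B. B). W (card B) * R B * h B (B - {i}))"
    by (rule sum.Sigma) (use finX X_D in \<open>auto simp: Y_def\<close>)
  also have "\<dots> = (\<Sum>(A,i)\<in>Sigma X (\<lambda>A. U - A). W (card A) * h (insert i A) A)"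
  proof (rule sum.reindex_bij_witness[of _ "\<lambda>(A,i). (insert i A, i)" "\<lambda>(B,i). (B - {i}, i)"])
    fix z assume z: "z \<in> Sigma Y (\<lambda>B. B)"
    then obtain B i where Bi: "z = (B, i)" "B \<in> X" "lev B \<noteq> 0" "i \<in> B" by (auto simp: Y_def)
    have c: "card B = n + 1 + lev B" "card (B - {i}) = n + lev B"
      using Bi X_D[OF Bi(2)] by auto
    obtain l where l: "lev B = Suc l" using Bi by (cases "lev B") auto
    have "W (card B) * R B = W (card (B - {i}))"
      using Wratio[of l] unfolding c R_def l by simp
    then show "(case (case z of (B, i) \<Rightarrow> (B - {i}, i)) of (A, i) \<Rightarrow> W (card A) * h (insert i A) A)
        = (case z of (B, i) \<Rightarrow> W (card B) * R B * h B (B - {i}))"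
      using Bi by (simp add: insert_absorb)
    show "(case z of (B, i) \<Rightarrow> (B - {i}, i)) \<in> Sigma X (\<lambda>A. U - A)"
      using Bi remove_X[OF Bi(2,4,3)] X_D[OF Bi(2)] by auto
    show "(case case z of (B, i) \<Rightarrow> (B - {i}, i) of (A, i) \<Rightarrow> (insert i A, i)) = z"
      using Bi by auto
  next
    fix z assume z: "z \<in> Sigma X (\<lambda>A. U - A)"
    then show "(case case z of (A, i) \<Rightarrow> (insert i A, i) of (B, i) \<Rightarrow> (B - {i}, i)) = z"
      by auto
    show "(case z of (A, i) \<Rightarrow> (insert i A, i)) \<in> Sigma Y (\<lambda>B. B)"
      using z insert_X by (auto simp: Y_def)
  qed
  also have "\<dots> = (\<Sum>A\<in>X. \<Sum>i\<in>U - A. W (card A) * h (insert i A) A)"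
    by (rule sum.Sigma[symmetric]) (use finX finU in auto)
  finally show ?thesis .
qed

lemma dirichlet_form:
  "(\<Sum>A\<in>X. W (card A) * f A * G g A)
    = - (\<Sum>A\<in>X. \<Sum>i\<in>U - A. W (card A) * ((f (insert i A) - f A) * (g (insert i A) - g A)))"
proof -
  have "(\<Sum>A\<in>X. W (card A) * f A * G g A)
     = (\<Sum>A\<in>X. \<Sum>i\<in>U - A. W (card A) * (f A * (g (insert i A) - g A)))
       + (\<Sum>B\<in>X. \<Sum>i\<in>B. W (card B) * R B * (f B * (g (B - {i}) - g B)))"
    by (simp add: G_def sum.distrib[symmetric] sum_distrib_left algebra_simps)
  also have "(\<Sum>B\<in>X. \<Sum>i\<in>B. W (card B) * R B * (f B * (g (B - {i}) - g B)))
     = (\<Sum>A\<in>X. \<Sum>i\<in>U - A. W (card A) * (f (insert i A) * (g A - g (insert i A))))"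
    by (rule down_sum[of "\<lambda>B A. f B * (g A - g B)"])
  finally show ?thesis
    by (simp add: sum.distrib[symmetric] sum_negf[symmetric] algebra_simps)
qed

lemma R_bounds: "0 \<le> R A" "R A \<le> 1"
  using q by (auto simp: R_def power_le_one)

text \<open>The moves down are blocked on the lowest level. A pair \<open>A\<close>, \<open>insert i A\<close> with \<open>A\<close> on that level
  therefore turns into a pair differing by a swap, so swaps need their own (small) distance \<open>s\<close>.\<close>

definition lipschitz_by :: "(nat \<Rightarrow> real) \<Rightarrow> real \<Rightarrow> real \<Rightarrow> ('a set \<Rightarrow> real) \<Rightarrow> bool" where
  "lipschitz_by d s B f \<longleftrightarrow>
     (\<forall>A\<in>X. \<forall>i\<in>U - A. \<bar>f (insert i A) - f A\<bar> \<le> B * d (lev A)) \<and>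
     (\<forall>A\<in>X. \<forall>i\<in>U - A. \<forall>j\<in>A. \<bar>f (insert i (A - {j})) - f A\<bar> \<le> B * s)"

text \<open>Additions of a spin other than \<open>i\<close> are coupled, and the flip of
  \<open>i\<close> in either configuration contributes only to the loss term. Removals from
  \<open>insert i A\<close> and from \<open>A\<close> stay in separate sums, because their rates
  differ and those from \<open>A\<close> vanish on the lowest level.\<close>

lemma G_diff_edge:
  assumes "A \<in> X" "i \<in> U - A"
  defines "k \<equiv> real (card A)"
  shows "G f (insert i A) - G f A =
     (\<Sum>j\<in>U - insert i A. f (insert j (insert i A)) - f (insert j A))
     + R (insert i A) * (\<Sum>j\<in>A. f (insert i (A - {j})) - f A)
     - R A * (\<Sum>j\<in>A. f (A - {j}) - f A)
     - (2 * real n + 1 - k + R (insert i A) * (k + 1)) * (f (insert i A) - f A)"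
proof -
  note A = X_D[OF assms(1)]
  define C where "C = insert i A"
  define D where "D = f C - f A"
  have UA: "U - A = insert i (U - C)" using assms(2) by (auto simp: C_def)
  have "card (U - C) = 2 * n + 1 - (card A + 1)"
    using assms(2) A finU cardU by (subst card_Diff_subset) (auto simp: C_def)
  moreover have "card A + 1 \<le> 2 * n + 1" 
    using card_mono[OF finU, of C] assms(2) A cardU by (simp add: C_def)
  ultimately have cUC: "real (card (U - C)) = 2 * real n - k" by (simp add: k_def of_nat_diff)
  have "(\<Sum>j\<in>C. f (C - {j}) - f C) = (f A - f C) + (\<Sum>j\<in>A. f (insert i (A - {j})) - f C)"
  proof -
    have "(\<Sum>j\<in>A. f (C - {j}) - f C) = (\<Sum>j\<in>A. f (insert i (A - {j})) - f C)"
    proof (rule sum.cong)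
      fix j assume "j \<in> A"
      then have "C - {j} = insert i (A - {j})" using assms(2) by (auto simp: C_def)
      then show "f (C - {j}) - f C = f (insert i (A - {j})) - f C" by simp
    qed simp
    moreover have "C - {i} = A" using assms(2) by (auto simp: C_def)
    moreover have "(\<Sum>j\<in>C. f (C - {j}) - f C) = (f (C - {i}) - f C) + (\<Sum>j\<in>A. f (C - {j}) - f C)"
      using assms(2) A unfolding C_def by (subst sum.insert) auto
    ultimately show ?thesis by simp
  qed
  also have "\<dots> = (\<Sum>j\<in>A. f (insert i (A - {j})) - f A) - (k + 1) * D"
    by (simp add: D_def sum_subtractf k_def algebra_simps)
  finally have down: "(\<Sum>j\<in>C. f (C - {j}) - f C)
      = (\<Sum>j\<in>A. f (insert i (A - {j})) - f A) - (k + 1) * D" .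
  have "(\<Sum>j\<in>U - C. f (insert j C) - f C) - (\<Sum>j\<in>U - A. f (insert j A) - f A)
     = (\<Sum>j\<in>U - C. f (insert j C) - f (insert j A)) - (2 * real n - k) * D - D"
  proof -
    have "(\<Sum>j\<in>U - A. f (insert j A) - f A) = D + (\<Sum>j\<in>U - C. f (insert j A) - f A)"
      unfolding UA D_def using finU by (subst sum.insert) (auto simp: C_def)
    moreover have "(\<Sum>j\<in>U - C. f (insert j C) - f C) - (\<Sum>j\<in>U - C. f (insert j A) - f A)
       = (\<Sum>j\<in>U - C. f (insert j C) - f (insert j A)) - (2 * real n - k) * D"
      by (simp add: sum_subtractf cUC D_def algebra_simps)
    ultimately show ?thesis by linarith
  qed
  then show ?thesis
    unfolding G_def C_def[symmetric] D_def[symmetric] down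
    by (simp add: algebra_simps)
qed

text \<open>Both configurations have the same level and hence the same rates. Flips of other spins
  are coupled; the flips of \<open>i\<close> and \<open>j\<close> are paired so that both
  configurations move to \<open>insert i A\<close> or both to \<open>A - {j}\<close>, and so enter
  only the loss term.\<close>

lemma G_diff_swap:
  assumes "A \<in> X" "i \<in> U - A" "j \<in> A"
  defines "k \<equiv> real (card A)" and "C \<equiv> insert i (A - {j})"
  shows "G f C - G f A =
     (\<Sum>l\<in>U - A - {i}. f (insert i (insert l A - {j})) - f (insert l A))
     + R A * (\<Sum>l\<in>A - {j}. f (insert i (A - {l} - {j})) - f (A - {l}))
     - (2 * real n + 1 - k + R A * k) * (f C - f A)"
proof -
  note A = X_D[OF assms(1)]
  define D where "D = f C - f A"
  have UC: "U - C = insert j (U - A - {i})" using assms(2,3) A by (auto simp: C_def)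
  have UA: "U - A = insert i (U - A - {i})" using assms(2) by auto
  have jC: "insert j C = insert i A" using assms(3) by (auto simp: C_def)
  have iC: "C - {i} = A - {j}" using assms(2) by (auto simp: C_def)
  have cU: "real (card (U - A - {i})) = 2 * real n - k"
  proof -
    have "card (U - A) = 2 * n + 1 - card A" using A finU cardU by (simp add: card_Diff_subset)
    moreover have "card (U - A) > 0" using assms(2) finU by (auto simp: card_gt_0_iff)
    ultimately show ?thesis using assms(2) finU by (simp add: k_def)
  qed
  have cA: "real (card (A - {j})) = k - 1"
  proof -
    have "card A > 0" using assms(3) A by (auto simp: card_gt_0_iff)
    then show ?thesis using assms(3) A by (simp add: k_def of_nat_diff)
  qed
  have up: "(\<Sum>l\<in>U - C. f (insert l C) - f C) - (\<Sum>l\<in>U - A. f (insert l A) - f A)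
     = (\<Sum>l\<in>U - A - {i}. f (insert i (insert l A - {j})) - f (insert l A)) - (2 * real n - k) * D - D"
  proof -
    have 1: "(\<Sum>l\<in>U - C. f (insert l C) - f C)
       = (f (insert i A) - f C) + (\<Sum>l\<in>U - A - {i}. f (insert l C) - f C)"
      unfolding UC using finU assms(3) by (subst sum.insert) (auto simp: jC)
    have 2: "(\<Sum>l\<in>U - A. f (insert l A) - f A)
       = (f (insert i A) - f A) + (\<Sum>l\<in>U - A - {i}. f (insert l A) - f A)"
      by (subst UA, subst sum.insert) (use finU in auto)
    have 3: "(\<Sum>l\<in>U - A - {i}. f (insert i (insert l A - {j})))
        = (\<Sum>l\<in>U - A - {i}. f (insert l C))"
    proof (rule sum.cong)
      fix l assume "l \<in> U - A - {i}"
      then have "insert i (insert l A - {j}) = insert l C" using assms(3) by (auto simp: C_def)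
      then show "f (insert i (insert l A - {j})) = f (insert l C)" by simp
    qed simp
    have "(\<Sum>l\<in>U - A - {i}. f (insert l C) - f C) - (\<Sum>l\<in>U - A - {i}. f (insert l A) - f A)
       = (\<Sum>l\<in>U - A - {i}. f (insert i (insert l A - {j})) - f (insert l A)) - (2 * real n - k) * D"
      by (simp add: 3 sum_subtractf cU D_def algebra_simps)
    then show ?thesis using 1 2 D_def by linarith
  qed
  have down: "(\<Sum>l\<in>C. f (C - {l}) - f C) - (\<Sum>l\<in>A. f (A - {l}) - f A)
     = (\<Sum>l\<in>A - {j}. f (insert i (A - {l} - {j})) - f (A - {l})) - k * D"
  proof -
    have 1: "(\<Sum>l\<in>C. f (C - {l}) - f C)
       = (f (A - {j}) - f C) + (\<Sum>l\<in>A - {j}. f (C - {l}) - f C)"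
    proof -
      have "(\<Sum>l\<in>insert i (A - {j}). f (C - {l}) - f C)
        = (f (C - {i}) - f C) + (\<Sum>l\<in>A - {j}. f (C - {l}) - f C)"
        using assms(2) A by (subst sum.insert) auto
      then show ?thesis unfolding iC by (simp add: C_def)
    qed
    have 2: "(\<Sum>l\<in>A. f (A - {l}) - f A) = (f (A - {j}) - f A) + (\<Sum>l\<in>A - {j}. f (A - {l}) - f A)"
      using assms(3) A by (simp add: sum.remove)
    have 3: "(\<Sum>l\<in>A - {j}. f (insert i (A - {l} - {j}))) = (\<Sum>l\<in>A - {j}. f (C - {l}))"
    proof (rule sum.cong)
      fix l assume "l \<in> A - {j}"
      then have "insert i (A - {l} - {j}) = C - {l}" using assms(2) by (auto simp: C_def)
      then show "f (insert i (A - {l} - {j})) = f (C - {l})" by simp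
    qed simp
    have "(\<Sum>l\<in>A - {j}. f (C - {l}) - f C) - (\<Sum>l\<in>A - {j}. f (A - {l}) - f A)
       = (\<Sum>l\<in>A - {j}. f (insert i (A - {l} - {j})) - f (A - {l})) - (k - 1) * D"
      by (simp add: 3 sum_subtractf cA D_def algebra_simps)
    moreover have "k * D = (k - 1) * D + D" by (simp add: algebra_simps)
    ultimately show ?thesis using 1 2 D_def by linarith
  qed
  have "G f C - G f A = ((\<Sum>l\<in>U - C. f (insert l C) - f C) - (\<Sum>l\<in>U - A. f (insert l A) - f A))
    + R A * ((\<Sum>l\<in>C. f (C - {l}) - f C) - (\<Sum>l\<in>A. f (A - {l}) - f A))"
    using swap_X(3)[OF assms(1-3)] unfolding G_def C_def[symmetric] by (simp add: algebra_simps)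
  then show ?thesis unfolding up down D_def[symmetric] by (simp add: algebra_simps)
qed

section \<open>Contraction of the weighted Lipschitz seminorm\<close>

definition T :: "('a set \<Rightarrow> real) \<Rightarrow> 'a set \<Rightarrow> real" where
  "T f A = f A + G f A / (2 * real n + 2)"

lemma lev_bounds: "A \<in> X \<Longrightarrow> lev A \<le> n" "A \<in> X \<Longrightarrow> i \<in> U - A \<Longrightarrow> lev A < n"
proof -
  assume A: "A \<in> X"
  show "lev A \<le> n" using card_mono[OF finU X_D(1)[OF A]] cardU by (simp add: lev_def)
  assume "i \<in> U - A"
  then have "card A < card U" using X_D(1)[OF A] finU by (intro psubset_card_mono) auto
  then show "lev A < n" using cardU A by (auto simp: lev_def X_def)
qed

text \<open>The loss rate exceeds the gain by \<open>1 + R A\<close>. The pair merges at rate one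
  through the common configuration \<open>insert i A\<close>, while the coupled moves of other spins
  turn a swap into a swap.\<close>

lemma T_swap_contraction:
  assumes f: "lipschitz_by d s B f" and A: "A \<in> X" "i \<in> U - A" "j \<in> A" and B: "B * s \<ge> 0"
  shows "\<bar>T f (insert i (A - {j})) - T f A\<bar> \<le> (1 - 1 / (2 * real n + 2)) * (B * s)"
proof -
  define c where "c = 1 / (2 * real n + 2)"
  define k where "k = real (card A)"
  define C where "C = insert i (A - {j})"
  define x where "x = 2 * real n + 1 - k + R A * k"
  define E where "E = (\<Sum>l\<in>U - A - {i}. f (insert i (insert l A - {j})) - f (insert l A))
     + R A * (\<Sum>l\<in>A - {j}. f (insert i (A - {l} - {j})) - f (A - {l}))"
  note XA = X_D[OF A(1)]
  have sw: "\<bar>f (insert i (A' - {j})) - f A'\<bar> \<le> B * s" if "A' \<in> X" "i \<in> U - A'" "j \<in> A'" for A'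
    using f that unfolding lipschitz_by_def by blast
  have c0: "0 \<le> c" by (simp add: c_def)
  have cU: "real (card (U - A - {i})) = 2 * real n - k"
  proof -
    have "card (U - A) = 2 * n + 1 - card A" using XA finU cardU by (simp add: card_Diff_subset)
    moreover have "card (U - A) > 0" using A(2) finU by (auto simp: card_gt_0_iff)
    ultimately show ?thesis using A(2) finU by (simp add: k_def)
  qed
  have cA: "real (card (A - {j})) = k - 1"
  proof -
    have "card A > 0" using A(3) XA by (auto simp: card_gt_0_iff)
    then show ?thesis using A(3) XA by (simp add: k_def of_nat_diff)
  qed
  have k0: "k \<ge> 1" using cA by linarith
  have E1: "\<bar>\<Sum>l\<in>U - A - {i}. f (insert i (insert l A - {j})) - f (insert l A)\<bar>
      \<le> (2 * real n - k) * (B * s)"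
    unfolding cU[symmetric] by (rule abs_sum_le, rule sw) (use insert_X A in auto)
  have E2: "\<bar>R A * (\<Sum>l\<in>A - {j}. f (insert i (A - {l} - {j})) - f (A - {l}))\<bar>
      \<le> R A * (k - 1) * (B * s)"
  proof (cases "lev A = 0")
    case True then show ?thesis by (simp add: R_def)
  next
    case False
    have "\<bar>\<Sum>l\<in>A - {j}. f (insert i (A - {l} - {j})) - f (A - {l})\<bar> \<le> (k - 1) * (B * s)"
      unfolding cA[symmetric] by (rule abs_sum_le, rule sw) (use remove_X A False in auto)
    then have "R A * \<bar>\<Sum>l\<in>A - {j}. f (insert i (A - {l} - {j})) - f (A - {l})\<bar>
        \<le> R A * ((k - 1) * (B * s))"
      using R_bounds[of A] by (intro mult_left_mono)
    then show ?thesis using R_bounds(1)[of A] by (simp add: abs_mult mult.assoc)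
  qed
  have E: "\<bar>E\<bar> \<le> (2 * real n - k + R A * (k - 1)) * (B * s)"
    using E1 E2 unfolding E_def distrib_right by linarith
  have "R A * k \<le> 1 * k" using R_bounds[of A] k0 by (intro mult_right_mono) auto
  then have cx: "c * x \<le> 1" unfolding c_def x_def by (simp add: divide_simps)
  have "T f C - T f A = (f C - f A) + c * (G f C - G f A)"
    by (simp add: T_def c_def diff_divide_distrib)
  also have "G f C - G f A = E - x * (f C - f A)"
    unfolding C_def E_def x_def k_def by (rule G_diff_swap[OF A])
  also have "\<bar>(f C - f A) + c * (E - x * (f C - f A))\<bar>
     \<le> (1 - c * x) * (B * s) + c * ((2 * real n - k + R A * (k - 1)) * (B * s))"
    using c0 cx E sw[OF A] unfolding C_def[symmetric] by (intro convex_step_bound)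
  also have "\<dots> = (1 - c - c * R A) * (B * s)" by (simp add: x_def algebra_simps)
  also have "\<dots> \<le> (1 - c) * (B * s)"
    using c0 R_bounds[of A] B by (intro mult_right_mono) auto
  finally show ?thesis by (simp add: C_def c_def)
qed

text \<open>Loss minus gain is \<open>B\<close> times the left side of \<open>eq\<close>, apart from
  the cost \<eta> of the swaps, so one step lowers the bound \<open>B * d\<close> by
  \<open>c * (B - \<eta>)\<close>. The bound \<open>d \<le> 9 * N\<close> turns this into a relative
  decrease.\<close>

lemma T_edge_contraction:
  assumes f: "lipschitz_by d s B f" and A: "A \<in> X" "i \<in> U - A" and B: "B \<ge> 0"
    and N_def: "N = real (2 * n + 1)"
    and a_def: "a = (\<lambda>i. if i = 0 then 0 else (real n + 1 + real i) * q ^ i)"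
    and b_def: "b = (\<lambda>i. real n - real i)"
    and d: "\<And>i. i < n \<Longrightarrow> d i \<ge> 0" "\<And>i. i < n \<Longrightarrow> d i \<le> 9 * N" "d 0 \<le> 1"
    and eq: "\<And>i. i < n \<Longrightarrow> (a (Suc i) + b i) * d i - a i * d (i - 1) - b (Suc i) * d (Suc i) = 1"
    and s: "s = 1 / (2 * (real n + 1))"
  shows "\<bar>T f (insert i A) - T f A\<bar> \<le> (1 - 1 / (2 * real n + 2) / (9 * N)) * (B * d (lev A))"
proof -
  define c where "c = 1 / (2 * real n + 2)"
  define k where "k = real (card A)"
  define l where "l = lev A"
  define C where "C = insert i A"
  note XA = X_D[OF A(1)]
  have ln: "l < n" using lev_bounds(2)[OF A] by (simp add: l_def)
  have N3: "N \<ge> 3" using ln by (simp add: N_def)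
  have k: "k = real n + 1 + real l" using XA(3) by (simp add: k_def l_def)
  have RC: "R C = q ^ Suc l" "lev C = Suc l" using insert_X[OF A] by (auto simp: R_def C_def l_def)
  define x where "x = 2 * real n + 1 - k + R C * (k + 1)"
  define E where "E = (\<Sum>j\<in>U - C. f (insert j C) - f (insert j A))
     + R C * (\<Sum>j\<in>A. f (insert i (A - {j})) - f A) - R A * (\<Sum>j\<in>A. f (A - {j}) - f A)"
  have x: "x = a (Suc l) + b l" by (simp add: x_def k RC a_def b_def algebra_simps)
  have c0: "0 \<le> c" by (simp add: c_def)
  \<comment> \<open>The coefficient \<open>x\<close> can be as large as \<open>2 * n + 2\<close>,
    whence the time step in \<open>T\<close>.\<close>
  have "R C * (k + 1) \<le> 1 * (k + 1)" using R_bounds[of C] k by (intro mult_right_mono) auto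
  then have cx: "c * x \<le> 1" unfolding c_def x_def by (simp add: divide_simps)
  have ed: "\<bar>f (insert i A') - f A'\<bar> \<le> B * d (lev A')" if "A' \<in> X" "i \<in> U - A'" for A' i
    using f that unfolding lipschitz_by_def by blast
  have sw: "\<bar>f (insert i (A - {j})) - f A\<bar> \<le> B * s" if "j \<in> A" for j
    using f that A unfolding lipschitz_by_def by blast
  have "card (U - C) + card C = card U"
    using A XA finU by (metis C_def card_Diff_subset card_mono finite_insert insert_X(1) X_D(1) le_add_diff_inverse2)
  moreover have "card C = card A + 1" using A XA by (simp add: C_def)
  ultimately have cUC: "real (card (U - C)) = b (Suc l)" using k cardU by (simp add: b_def k_def)
  have E1: "\<bar>\<Sum>j\<in>U - C. f (insert j C) - f (insert j A)\<bar> \<le> b (Suc l) * (B * d (Suc l))"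
    unfolding cUC[symmetric]
  proof (rule abs_sum_le)
    fix j assume j: "j \<in> U - C"
    then have *: "insert j A \<in> X" "i \<in> U - insert j A" "lev (insert j A) = Suc l"
      using insert_X[OF A(1), of j] A by (auto simp: C_def l_def)
    have "insert j C = insert i (insert j A)" by (auto simp: C_def)
    then show "\<bar>f (insert j C) - f (insert j A)\<bar> \<le> B * d (Suc l)" using ed[OF *(1,2)] *(3) by simp
  qed
  \<comment> \<open>On the lowest level the removals from \<open>C\<close> have no counterpart,
    since those from \<open>A\<close> are blocked; they produce swaps, whose cost is \<eta>.\<close>
  define \<eta> where "\<eta> = (if l = 0 then R C * k * (B * s) else 0)"
  have E2: "\<bar>R C * (\<Sum>j\<in>A. f (insert i (A - {j})) - f A) - R A * (\<Sum>j\<in>A. f (A - {j}) - f A)\<bar>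
      \<le> a l * (B * d (l - 1)) + \<eta>"
  proof (cases "l = 0")
    case True
    have "\<bar>\<Sum>j\<in>A. f (insert i (A - {j})) - f A\<bar> \<le> k * (B * s)"
      unfolding k_def by (rule abs_sum_le, rule sw)
    then have "R C * \<bar>\<Sum>j\<in>A. f (insert i (A - {j})) - f A\<bar> \<le> R C * (k * (B * s))"
      using R_bounds[of C] by (intro mult_left_mono)
    moreover have "R A = 0" using True by (simp add: R_def l_def)
    ultimately show ?thesis using R_bounds(1)[of C] True
      by (simp add: a_def \<eta>_def abs_mult mult.assoc)
  next
    case False
    define S2 where "S2 = (\<Sum>j\<in>A. f (insert i (A - {j})) - f (A - {j}))"
    define S3 where "S3 = (\<Sum>j\<in>A. f (A - {j}) - f A)"
    have rm: "A - {j} \<in> X" "lev (A - {j}) = l - 1" if "j \<in> A" for j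
      using remove_X[OF A(1) that] False by (auto simp: l_def)
    have S2: "\<bar>S2\<bar> \<le> k * (B * d (l - 1))" unfolding S2_def k_def
    proof (rule abs_sum_le)
      fix j assume "j \<in> A"
      then show "\<bar>f (insert i (A - {j})) - f (A - {j})\<bar> \<le> B * d (l - 1)"
        using ed[of "A - {j}" i] rm A by auto
    qed
    have S3: "\<bar>S3\<bar> \<le> k * (B * d (l - 1))" unfolding S3_def k_def
    proof (rule abs_sum_le)
      fix j assume j: "j \<in> A"
      then have "insert j (A - {j}) = A" "j \<in> U - (A - {j})" using XA by auto
      then show "\<bar>f (A - {j}) - f A\<bar> \<le> B * d (l - 1)"
        using ed[of "A - {j}" j] rm[OF j] by (simp add: abs_minus_commute)
    qed
    have RA: "R A = q ^ l" using False by (simp add: R_def l_def)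
    \<comment> \<open>Removals are coupled at the smaller rate \<open>R C\<close>. The excess
      \<open>R A - R C\<close> moves only the lower configuration, so both contributions are edges
      one level down and together have rate \<open>R A\<close>.\<close>
    have RR: "R C \<le> R A" using q by (simp add: RC RA mult_left_le_one_le)
    have "(\<Sum>j\<in>A. f (insert i (A - {j})) - f A) = S2 + S3"
      by (simp add: S2_def S3_def sum.distrib[symmetric])
    then have "R C * (\<Sum>j\<in>A. f (insert i (A - {j})) - f A) - R A * (\<Sum>j\<in>A. f (A - {j}) - f A)
       = R C * S2 + - ((R A - R C) * S3)" by (simp add: S3_def algebra_simps)
    also have "\<bar>\<dots>\<bar> \<le> \<bar>R C * S2\<bar> + \<bar>- ((R A - R C) * S3)\<bar>" by (rule abs_triangle_ineq)
    also have "\<dots> = R C * \<bar>S2\<bar> + (R A - R C) * \<bar>S3\<bar>"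
      using RR R_bounds[of C] by (simp add: abs_mult)
    also have "\<dots> \<le> R C * (k * (B * d (l - 1))) + (R A - R C) * (k * (B * d (l - 1)))"
      using S2 S3 RR R_bounds[of C] by (intro add_mono mult_left_mono) auto
    also have "\<dots> = a l * (B * d (l - 1)) + \<eta>"
      using False by (simp add: RA \<eta>_def a_def k algebra_simps)
    finally show ?thesis .
  qed
  have \<eta>: "\<eta> \<le> B * (1 - d l / (9 * N))"
  proof (cases "l = 0")
    case True
    \<comment> \<open>On the lowest level \<open>k = n + 1\<close>, and \<open>s\<close> is chosen
      so that all swaps together cost at most \<open>B / 2\<close>. The term
      \<open>d 0 / (9 * N)\<close> is below the remaining half because
      \<open>d 0 \<le> 1\<close>.\<close>
    have "R C * (k * (B * s)) \<le> 1 * (k * (B * s))"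
      using R_bounds[of C] B k s by (intro mult_right_mono) auto
    moreover have "k * s = 1 / 2" using True by (simp add: k s)
    then have "k * (B * s) = B * (1 / 2)" by (metis mult.left_commute)
    moreover have "B * (1 / 2) \<le> B * (1 - d l / (9 * N))"
      using d(3) N3 True B by (intro mult_left_mono) (auto simp: divide_simps)
    moreover have "\<eta> = R C * (k * (B * s))" using True by (simp add: \<eta>_def mult.assoc)
    ultimately show ?thesis by linarith
  next
    case False
    then show ?thesis using d(2)[OF ln] N3 B by (simp add: \<eta>_def divide_simps)
  qed
  have E: "\<bar>E\<bar> \<le> b (Suc l) * (B * d (Suc l)) + (a l * (B * d (l - 1)) + \<eta>)"
    using E1 E2 unfolding E_def by linarith
  have "T f C - T f A = (f C - f A) + c * (G f C - G f A)"
    by (simp add: T_def c_def diff_divide_distrib)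
  also have "G f C - G f A = E - x * (f C - f A)"
    unfolding C_def E_def x_def k_def by (rule G_diff_edge[OF A])
  also have "\<bar>(f C - f A) + c * (E - x * (f C - f A))\<bar>
     \<le> (1 - c * x) * (B * d l) + c * (b (Suc l) * (B * d (Suc l)) + (a l * (B * d (l - 1)) + \<eta>))"
    using c0 cx E ed[OF A] unfolding C_def[symmetric] l_def[symmetric] by (intro convex_step_bound)
  also have "\<dots> = B * d l - c * (B * (x * d l - a l * d (l - 1) - b (Suc l) * d (Suc l)) - \<eta>)"
    by (simp add: algebra_simps)
  also have "\<dots> = B * d l - c * (B - \<eta>)" using eq[OF ln] by (simp add: x)
  also have "\<dots> \<le> B * d l - c * (B * d l / (9 * N))"
    using \<eta> c0 by (intro diff_left_mono mult_left_mono) (auto simp: right_diff_distrib)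
  also have "\<dots> = (1 - c / (9 * N)) * (B * d l)" by (simp add: algebra_simps)
  finally show ?thesis by (simp add: C_def c_def l_def)
qed

lemma lipschitz_by_exists:
  assumes d: "\<And>i. i < n \<Longrightarrow> d i > 0" and s: "s > 0"
  shows "\<exists>B\<ge>0. lipschitz_by d s B f"
proof -
  define \<delta> where "\<delta> = Min (insert s (d ` {..<n}))"
  have \<delta>: "\<delta> > 0" "\<delta> \<le> s" "\<And>i. i < n \<Longrightarrow> \<delta> \<le> d i"
    unfolding \<delta>_def using d s by (auto intro: Min_le)
  define K where "K = (\<Sum>A\<in>X. \<bar>f A\<bar>)"
  have K: "\<bar>f A - f B\<bar> \<le> 2 * K" if "A \<in> X" "B \<in> X" for A B
  proof -
    have "\<bar>f A\<bar> \<le> K" "\<bar>f B\<bar> \<le> K"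
      unfolding K_def using that finX by (auto intro!: member_le_sum)
    then show ?thesis by linarith
  qed
  have K0: "K \<ge> 0" unfolding K_def by (intro sum_nonneg) auto
  have bd: "2 * K \<le> 2 * K / \<delta> * e" if "\<delta> \<le> e" for e
  proof -
    have "2 * K / \<delta> * \<delta> \<le> 2 * K / \<delta> * e" using that K0 \<delta> by (intro mult_left_mono) auto
    then show ?thesis using \<delta> by simp
  qed
  have "lipschitz_by d s (2 * K / \<delta>) f"
    unfolding lipschitz_by_def
  proof (intro conjI ballI)
    fix A i assume A: "A \<in> X" "i \<in> U - A"
    show "\<bar>f (insert i A) - f A\<bar> \<le> 2 * K / \<delta> * d (lev A)"
      using K[OF insert_X(1)[OF A] A(1)] bd[OF \<delta>(3)[OF lev_bounds(2)[OF A]]] by linarith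
    fix j assume j: "j \<in> A"
    show "\<bar>f (insert i (A - {j})) - f A\<bar> \<le> 2 * K / \<delta> * s"
      using K[OF swap_X(1)[OF A j] A(1)] bd[OF \<delta>(2)] by linarith
  qed
  then show ?thesis using K0 \<delta> by (intro exI[of _ "2 * K / \<delta>"]) auto
qed

lemma lipschitz_by_diameter:
  assumes f: "lipschitz_by d s B f" and d: "\<And>i. i < n \<Longrightarrow> d i \<le> D" and B: "B \<ge> 0" "D \<ge> 0" and A: "A \<in> X"
  shows "\<bar>f U - f A\<bar> \<le> B * D * (2 * real n + 1)"
proof -
  have "\<bar>f U - f A\<bar> \<le> B * D * real (card (U - A))"
    using A
  proof (induction "card (U - A)" arbitrary: A)
    case 0
    then have "U - A = {}" using finU by simp
    then have "A = U" using X_D(1)[OF 0(2)] by auto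
    then show ?case by simp
  next
    case (Suc m)
    then obtain i where i: "i \<in> U - A" by (metis card.empty equals0I nat.distinct(1))
    have UA: "U - A = insert i (U - insert i A)" using i by auto
    have m: "card (U - insert i A) = m"
      using Suc(2) finU by (subst (asm) UA) (simp add: card_insert_if)
    have "\<bar>f U - f (insert i A)\<bar> \<le> B * D * real m"
      using Suc(1)[of "insert i A"] insert_X(1)[OF Suc(3) i] m by simp
    moreover have "\<bar>f (insert i A) - f A\<bar> \<le> B * d (lev A)"
      using f Suc(3) i unfolding lipschitz_by_def by blast
    moreover have "B * d (lev A) \<le> B * D"
      using d[OF lev_bounds(2)[OF Suc(3) i]] B by (intro mult_left_mono)
    ultimately have "\<bar>f U - f A\<bar> \<le> B * D * real m + B * D" by linarith
    then show ?case using Suc(2)[symmetric] by (simp add: algebra_simps)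
  qed
  also have "\<dots> \<le> B * D * (2 * real n + 1)"
  proof (rule mult_left_mono)
    have "card (U - A) \<le> 2 * n + 1" using card_mono[OF finU, of "U - A"] cardU by auto
    then show "real (card (U - A)) \<le> 2 * real n + 1" by linarith
    show "0 \<le> B * D" using B by simp
  qed
  finally show ?thesis .
qed

text \<open>The iterates of \<open>T\<close> contract the seminorm by \<rho>, so the correlations of
  \<open>f\<close> decay like \<open>\<rho> ^ k\<close>; the prefactor depends on \<open>f\<close>
  but disappears in the Rayleigh bound. Since \<open>T\<close> is the identity plus
  \<open>c * G\<close>, the bound \<rho> on its Rayleigh quotient is a gap
  \<open>1 / (9 * N)\<close> for \<open>G\<close>.\<close>

lemma poincare:
  assumes mean: "(\<Sum>A\<in>X. W (card A) * f A) = 0"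
  shows "(\<Sum>A\<in>X. W (card A) * (f A)\<^sup>2)
    \<le> 9 * real (2 * n + 1) * (\<Sum>A\<in>X. \<Sum>i\<in>U - A. W (card A) * (f (insert i A) - f A)\<^sup>2)"
proof (cases "n = 0")
  case True
  then have card1: "card U = 1" using cardU by simp
  have XU: "X = {U}" 
  proof -
    have "A = U" if "A \<in> X" for A
      using that finU card1 by (intro card_seteq) (auto simp: X_def)
    moreover have "U \<in> X" unfolding X_def using card1 True by simp
    ultimately show ?thesis by blast
  qed
  then have "f U = 0" using mean Wpos[of "card U"] by simp
  then show ?thesis by (simp add: XU)
next
  case False
  define N where "N = real (2 * n + 1)"
  define a where "a = (\<lambda>i. if i = 0 then 0 else (real n + 1 + real i) * q ^ i)"
  define b where "b = (\<lambda>i. real n - real i)"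
  obtain d where d: "\<And>i. i < n \<Longrightarrow> 0 < d i" "\<And>i. i < n \<Longrightarrow> d i \<le> 9 * N" "d 0 \<le> 1"
    "\<And>i. i < n \<Longrightarrow> (a (Suc i) + b i) * d i - a i * d (i - 1) - b (Suc i) * d (Suc i) = 1"
    using birth_death_metric[of n q] False q unfolding N_def a_def b_def by blast
  define s where "s = 1 / (2 * (real n + 1))"
  have s: "s > 0" by (simp add: s_def)
  have N: "N \<ge> 3" using False by (simp add: N_def)
  define c where "c = 1 / (2 * real n + 2)"
  define \<rho> where "\<rho> = 1 - c / (9 * N)"
  have c: "0 < c" "c \<le> 1" by (auto simp: c_def)
  have cN: "c / (9 * N) < 1" "c / (9 * N) \<le> c" using c N by (auto simp: divide_simps)
  then have \<rho>: "\<rho> > 0" by (simp add: \<rho>_def)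
  have step: "lipschitz_by d s (\<rho> * B) (T g)" if g: "lipschitz_by d s B g" and B: "B \<ge> 0" for g B
    unfolding lipschitz_by_def
  proof (intro conjI ballI)
    fix A i assume A: "A \<in> X" "i \<in> U - A"
    show "\<bar>T g (insert i A) - T g A\<bar> \<le> \<rho> * B * d (lev A)"
      using T_edge_contraction[OF g A B N_def a_def b_def less_imp_le[OF d(1)] d(2-4) s_def]
      by (simp add: \<rho>_def c_def mult.assoc)
    fix j assume j: "j \<in> A"
    have "\<bar>T g (insert i (A - {j})) - T g A\<bar> \<le> (1 - c) * (B * s)"
      using T_swap_contraction[OF g A j] B s by (simp add: c_def)
    also have "\<dots> \<le> \<rho> * (B * s)" using B s cN by (intro mult_right_mono) (auto simp: \<rho>_def)
    finally show "\<bar>T g (insert i (A - {j})) - T g A\<bar> \<le> \<rho> * B * s" by (simp add: mult.assoc)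
  qed
  obtain B where B: "B \<ge> 0" "lipschitz_by d s B f" using lipschitz_by_exists[of d s f, OF d(1) s] by blast
  have iter: "lipschitz_by d s (\<rho> ^ k * B) ((T ^^ k) f)" for k
  proof (induction k)
    case 0 then show ?case using B by simp
  next
    case (Suc k) then show ?case using step[OF Suc] B \<rho> by (simp add: mult.assoc)
  qed
  define K where "K = (\<Sum>A\<in>X. W (card A) * \<bar>f A\<bar>) * (B * (9 * N) * (2 * real n + 1))"
  have decay: "(\<Sum>A\<in>X. W (card A) * f A * (T ^^ k) f A) \<le> K * \<rho> ^ k" for k
  proof -
    let ?g = "(T ^^ k) f"
    \<comment> \<open>As \<open>f\<close> has mean zero, the constant \<open>?g U\<close> may be
      subtracted; then only the oscillation of \<open>?g\<close> matters, and the seminorm controls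
      it.\<close>
    have "(\<Sum>A\<in>X. W (card A) * f A * ?g A)
       = (\<Sum>A\<in>X. W (card A) * f A * (?g A - ?g U)) + (\<Sum>A\<in>X. W (card A) * f A) * ?g U"
      unfolding sum_distrib_right sum.distrib[symmetric] by (intro sum.cong) (auto simp: algebra_simps)
    also have "\<dots> = (\<Sum>A\<in>X. W (card A) * f A * (?g A - ?g U))" by (simp add: mean)
    also have "\<dots> \<le> (\<Sum>A\<in>X. W (card A) * \<bar>f A\<bar> * (\<rho> ^ k * B * (9 * N) * (2 * real n + 1)))"
    proof (rule sum_mono)
      fix A assume A: "A \<in> X"
      have "\<bar>?g A - ?g U\<bar> \<le> \<rho> ^ k * B * (9 * N) * (2 * real n + 1)"
        using lipschitz_by_diameter[OF iter d(2) _ _ A] B N \<rho> by (simp add: abs_minus_commute)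
      then have "\<bar>W (card A) * f A * (?g A - ?g U)\<bar>
          \<le> W (card A) * \<bar>f A\<bar> * (\<rho> ^ k * B * (9 * N) * (2 * real n + 1))"
        unfolding abs_mult using Wpos[of "card A"] by (intro mult_mono) auto
      then show "W (card A) * f A * (?g A - ?g U)
          \<le> W (card A) * \<bar>f A\<bar> * (\<rho> ^ k * B * (9 * N) * (2 * real n + 1))" by linarith
    qed
    also have "\<dots> = K * \<rho> ^ k"
      unfolding K_def sum_distrib_right by (intro sum.cong) (auto simp: algebra_simps)
    finally show ?thesis .
  qed
  define E where "E g h = (\<Sum>A\<in>X. \<Sum>i\<in>U - A. W (card A) * ((g (insert i A) - g A) * (h (insert i A) - h A)))" for g h
  have T_ip: "(\<Sum>A\<in>X. W (card A) * g A * T h A) = (\<Sum>A\<in>X. W (card A) * g A * h A) - c * E g h" for g h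
  proof -
    have "(\<Sum>A\<in>X. W (card A) * g A * T h A)
       = (\<Sum>A\<in>X. W (card A) * g A * h A) + c * (\<Sum>A\<in>X. W (card A) * g A * G h A)"
      unfolding sum_distrib_left sum.distrib[symmetric]
      by (intro sum.cong) (auto simp: T_def c_def field_simps)
    then show ?thesis by (simp add: dirichlet_form E_def)
  qed
  have E_comm: "E g h = E h g" for g h by (simp add: E_def mult.commute)
  have comm: "(\<Sum>x\<in>X. W (card x) * g x * h x) = (\<Sum>x\<in>X. W (card x) * h x * g x)" for g h
    by (intro sum.cong) auto
  have sym: "(\<Sum>x\<in>X. W (card x) * g x * T h x) = (\<Sum>x\<in>X. W (card x) * T g x * h x)" for g h
  proof -
    have "(\<Sum>x\<in>X. W (card x) * T g x * h x) = (\<Sum>x\<in>X. W (card x) * h x * T g x)" by (rule comm)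
    also have "\<dots> = (\<Sum>x\<in>X. W (card x) * h x * g x) - c * E h g" by (rule T_ip)
    also have "\<dots> = (\<Sum>x\<in>X. W (card x) * g x * h x) - c * E g h"
      by (simp only: comm[of h g] E_comm[of h g])
    finally show ?thesis by (simp only: T_ip)
  qed
  have "(\<Sum>A\<in>X. W (card A) * f A * T f A) \<le> \<rho> * (\<Sum>A\<in>X. W (card A) * f A * f A)"
    by (rule self_adjoint_rayleigh_le[OF _ sym decay \<rho>]) (simp add: less_imp_le Wpos)
  then have "c * ((\<Sum>A\<in>X. W (card A) * f A * f A) / (9 * N)) \<le> c * E f f"
    unfolding T_ip by (simp add: \<rho>_def algebra_simps)
  then have "(\<Sum>A\<in>X. W (card A) * f A * f A) / (9 * N) \<le> E f f"
    using c(1) by (simp only: mult_le_cancel_left_pos)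
  then have "(\<Sum>A\<in>X. W (card A) * f A * f A) \<le> 9 * N * E f f"
    using N by (simp only: divide_le_eq) (simp add: mult.commute)
  then show ?thesis by (simp only: E_def N_def power2_eq_square mult.assoc)
qed

end

section \<open>The mean field Ising model\<close>

text \<open>Multiplied by \<open>\<pi> x\<close>, the jump rate becomes the symmetric conductance
  \<open>K x y * min (\<pi> x) (\<pi> y)\<close>, and the double sum can be symmetrised. The
  bilinear form is needed to test a function against its own negative part.\<close>

lemma metropolis_dirichlet_form:
  assumes fin: "finite S" and pos: "\<And>x. x \<in> S \<Longrightarrow> \<pi> x > 0"
    and sym: "\<And>x y. x \<in> S \<Longrightarrow> y \<in> S \<Longrightarrow> K x y = K y x"
  shows "(\<Sum>x\<in>S. \<pi> x * f x * mat_fun S (metropolis_gen S K \<pi>) g x)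
    = - (\<Sum>x\<in>S. \<Sum>y\<in>S. K x y * min (\<pi> x) (\<pi> y) * ((f x - f y) * (g x - g y))) / 2"
proof -
  define c where "c x y = K x y * min (\<pi> x) (\<pi> y)" for x y
  have c_sym: "c x y = c y x" if "x \<in> S" "y \<in> S" for x y
    using sym[OF that] by (simp add: c_def min.commute)
  have row: "\<pi> x * mat_fun S (metropolis_gen S K \<pi>) g x = (\<Sum>y\<in>S. c x y * (g y - g x))"
    if x: "x \<in> S" for x
  proof -
    have m: "\<pi> x * (K x y * min (\<pi> y / \<pi> x) 1) = c x y" for y
    proof -
      have "\<pi> x * min (\<pi> y / \<pi> x) 1 = min (\<pi> x) (\<pi> y)"
        using pos[OF x] by (auto simp: min_def divide_simps)
      then show ?thesis unfolding c_def by (metis mult.left_commute)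
    qed
    have "mat_fun S (metropolis_gen S K \<pi>) g x
       = metropolis_gen S K \<pi> x x * g x + (\<Sum>y\<in>S - {x}. metropolis_gen S K \<pi> x y * g y)"
      unfolding mat_fun_def using fin x by (simp add: sum.remove)
    also have "(\<Sum>y\<in>S - {x}. metropolis_gen S K \<pi> x y * g y)
       = (\<Sum>y\<in>S - {x}. K x y * min (\<pi> y / \<pi> x) 1 * g y)"
      by (intro sum.cong) (auto simp: metropolis_gen_def)
    also have "metropolis_gen S K \<pi> x x * g x = - (\<Sum>y\<in>S - {x}. K x y * min (\<pi> y / \<pi> x) 1 * g x)"
      by (simp add: metropolis_gen_def sum_distrib_right)
    finally have "\<pi> x * mat_fun S (metropolis_gen S K \<pi>) g x
       = (\<Sum>y\<in>S - {x}. \<pi> x * (K x y * min (\<pi> y / \<pi> x) 1) * (g y - g x))"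
      by (simp add: right_diff_distrib sum_subtractf sum_distrib_left mult.assoc)
    also have "\<dots> = (\<Sum>y\<in>S - {x}. c x y * (g y - g x))" by (simp only: m)
    also have "\<dots> = (\<Sum>y\<in>S. c x y * (g y - g x))"
      using fin x by (simp add: sum.remove[of S x])
    finally show ?thesis .
  qed
  define V where "V = (\<Sum>x\<in>S. \<Sum>y\<in>S. f x * (c x y * (g y - g x)))"
  have "(\<Sum>x\<in>S. \<pi> x * f x * mat_fun S (metropolis_gen S K \<pi>) g x)
     = (\<Sum>x\<in>S. f x * (\<pi> x * mat_fun S (metropolis_gen S K \<pi>) g x))"
    by (simp add: mult.assoc mult.left_commute)
  also have "\<dots> = V" unfolding V_def
    by (intro sum.cong refl) (simp add: row sum_distrib_left)
  finally have lhs: "(\<Sum>x\<in>S. \<pi> x * f x * mat_fun S (metropolis_gen S K \<pi>) g x) = V" .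
  have "V = (\<Sum>x\<in>S. \<Sum>y\<in>S. f y * (c x y * (g x - g y)))"
    unfolding V_def by (subst sum.swap) (intro sum.cong refl, simp add: c_sym)
  then have "2 * V = (\<Sum>x\<in>S. \<Sum>y\<in>S. f x * (c x y * (g y - g x)) + f y * (c x y * (g x - g y)))"
    by (simp add: sum.distrib V_def)
  also have "\<dots> = - (\<Sum>x\<in>S. \<Sum>y\<in>S. c x y * ((f x - f y) * (g x - g y)))"
    unfolding sum_negf[symmetric] by (intro sum.cong refl) (simp add: algebra_simps)
  finally show ?thesis unfolding lhs c_def by simp
qed

section \<open>Configurations as a majority sign and its set of spins\<close>

definition conf :: "nat \<Rightarrow> real \<Rightarrow> nat set \<Rightarrow> nat \<Rightarrow> real" where
  "conf N s A = (\<lambda>i\<in>{1..N}. if i \<in> A then s else - s)"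

text \<open>Through \<open>conf N s\<close>, with \<open>s\<close> the majority sign, both halves
  are indexed by the same sets, and one instance of the half-cube locale serves both signs. There
  are no ties because the number of spins is odd.\<close>

definition major :: "nat \<Rightarrow> nat set set" where
  "major n = {A. A \<subseteq> {1..2 * n + 1} \<and> n < card A}"

lemma finite_spins: "finite (spins N)"
  unfolding spins_def by (intro finite_PiE) auto

lemma conf_in_spins: "s \<in> {1, -1} \<Longrightarrow> conf N s A \<in> spins N"
  by (auto simp: conf_def spins_def split: if_splits)

lemma inj_conf: "s \<noteq> 0 \<Longrightarrow> inj_on (conf N s) (Pow {1..N})"
proof (rule inj_onI)
  fix A B assume s: "s \<noteq> 0" and A: "A \<in> Pow {1..N}" and B: "B \<in> Pow {1..N}" and eq: "conf N s A = conf N s B"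
  have "i \<in> A \<longleftrightarrow> i \<in> B" if "i \<in> {1..N}" for i
    using fun_cong[OF eq, of i] that s by (auto simp: conf_def split: if_splits)
  then show "A = B" using A B by blast
qed

lemma sum_conf:
  assumes "A \<subseteq> {1..N}"
  shows "(\<Sum>i=1..N. conf N s A i) = s * (2 * real (card A) - real N)"
proof -
  have "(\<Sum>i=1..N. conf N s A i) = (\<Sum>i\<in>{1..N}. 2 * s * indicator A i - s)"
    by (intro sum.cong) (auto simp: conf_def indicator_def)
  also have "\<dots> = 2 * s * (\<Sum>i\<in>{1..N}. indicator A i) - real N * s"
    by (simp add: sum_subtractf sum_distrib_left)
  also have "(\<Sum>i\<in>{1..N}. indicator A i) = (\<Sum>i\<in>A. 1 :: real)"
    by (rule sum.mono_neutral_cong_right) (use assms in auto)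
  finally show ?thesis by (simp add: algebra_simps)
qed

lemma ising_H_square: "ising_H N \<sigma> = - (\<Sum>i=1..N. \<sigma> i)\<^sup>2 / (2 * real N)"
  by (simp add: ising_H_def sum_product power2_eq_square)

lemma spins_split:
  "(\<Sum>\<sigma>\<in>spins (2 * n + 1). g \<sigma>) = (\<Sum>A\<in>major n. g (conf (2 * n + 1) 1 A)) + (\<Sum>A\<in>major n. g (conf (2 * n + 1) (-1) A))"
proof -
  define N where "N = 2 * n + 1"
  have sub: "major n \<subseteq> Pow {1..N}" by (auto simp: major_def N_def)
  have "spins N \<subseteq> conf N 1 ` major n \<union> conf N (-1) ` major n"
  proof
    fix \<sigma> assume \<sigma>: "\<sigma> \<in> spins N"
    define P where "P s = {i \<in> {1..N}. \<sigma> i = s}" for s :: real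
    have "P 1 \<union> P (-1) = {1..N}" "P 1 \<inter> P (-1) = {}"
      using \<sigma> by (auto simp: P_def spins_def)
    then have "card (P 1) + card (P (-1)) = N"
      by (metis card_Un_disjoint card_atLeastAtMost diff_Suc_1 finite_Un finite_atLeastAtMost)
    then have "P 1 \<in> major n \<or> P (-1) \<in> major n" by (auto simp: major_def P_def N_def)
    moreover have "\<sigma> = conf N s (P s)" if "s \<in> {1, -1}" for s
    proof
      fix i show "\<sigma> i = conf N s (P s) i"
        using \<sigma> that by (cases "i \<in> {1..N}") (auto simp: conf_def P_def spins_def)
    qed
    ultimately show "\<sigma> \<in> conf N 1 ` major n \<union> conf N (-1) ` major n" by (metis UnI1 UnI2 image_eqI insertCI)
  qed
  then have eq: "spins N = conf N 1 ` major n \<union> conf N (-1) ` major n"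
    using conf_in_spins by auto
  have disj: "conf N 1 ` major n \<inter> conf N (-1) ` major n = {}"
  proof -
    have "conf N 1 A \<noteq> conf N (-1) B" if "A \<in> major n" "B \<in> major n" for A B
    proof
      assume "conf N 1 A = conf N (-1) B"
      then have "1 * (2 * real (card A) - real N) = -1 * (2 * real (card B) - real N)"
        using sum_conf[of A N 1] sum_conf[of B N "-1"] that sub by (metis PowD in_mono)
      then show False using that by (auto simp: major_def N_def)
    qed
    then show ?thesis by auto
  qed
  have fin: "finite (major n)" using sub finite_subset by blast
  have "(\<Sum>\<sigma>\<in>spins N. g \<sigma>) = sum g (conf N 1 ` major n) + sum g (conf N (-1) ` major n)"
    unfolding eq using fin disj by (intro sum.union_disjoint) auto
  also have "\<dots> = (\<Sum>A\<in>major n. g (conf N 1 A)) + (\<Sum>A\<in>major n. g (conf N (-1) A))"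
    using inj_on_subset[OF inj_conf sub] by (simp add: sum.reindex)
  finally show ?thesis by (simp add: N_def)
qed

lemma hypercube_kernel_sym: "hypercube_kernel N x y = hypercube_kernel N y x"
proof -
  have "{i\<in>{1..N}. x i \<noteq> y i} = {i\<in>{1..N}. y i \<noteq> x i}" by auto
  then show ?thesis by (simp add: hypercube_kernel_def)
qed

lemma hypercube_kernel_conf:
  assumes "i \<in> {1..N} - A" "s \<noteq> 0"
  shows "hypercube_kernel N (conf N s A) (conf N s (insert i A)) = 1 / real N"
proof -
  have "{j\<in>{1..N}. conf N s A j \<noteq> conf N s (insert i A) j} = {i}"
    using assms by (auto simp: conf_def)
  then show ?thesis by (simp add: hypercube_kernel_def)
qed

lemma ising_mu_eq:
  "ising_mu N t \<sigma> = exp (- t * ising_H N \<sigma>) / (\<Sum>\<tau>\<in>spins N. exp (- t * ising_H N \<tau>))"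
  if "\<sigma> \<in> spins N"
proof -
  have ne: "spins N \<noteq> {}" using that by auto
  have p: "pmf (pmf_of_set (spins N)) \<tau> = 1 / real (card (spins N))" if "\<tau> \<in> spins N" for \<tau>
    using ne finite_spins that by simp
  have c: "real (card (spins N)) > 0" using ne finite_spins by (simp add: card_gt_0_iff)
  have "(\<Sum>\<tau>\<in>spins N. exp (- t * ising_H N \<tau>) * pmf (pmf_of_set (spins N)) \<tau>)
     = (\<Sum>\<tau>\<in>spins N. exp (- t * ising_H N \<tau>)) / real (card (spins N))"
    by (simp add: p sum_divide_distrib)
  then show ?thesis using that c by (simp add: ising_mu_def gibbs_def p)
qed

lemma spins_nonempty: "spins N \<noteq> {}"
  using conf_in_spins[of 1 N "{}"] by auto

lemma ising_Z_pos: "(\<Sum>\<tau>\<in>spins N. exp (- t * ising_H N \<tau>)) > 0"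
  using finite_spins spins_nonempty by (intro sum_pos) auto

lemma ising_mu_pos: "\<sigma> \<in> spins N \<Longrightarrow> ising_mu N t \<sigma> > 0"
  using ising_Z_pos by (simp add: ising_mu_eq)

lemma sum_ising_mu: "(\<Sum>\<sigma>\<in>spins N. ising_mu N t \<sigma>) = 1"
  using ising_Z_pos[where t=t and N=N] by (simp add: ising_mu_eq sum_divide_distrib[symmetric])

lemma ising_H_bounds:
  assumes "\<sigma> \<in> spins N"
  shows "- real N / 2 \<le> ising_H N \<sigma>" "ising_H N \<sigma> \<le> 0"
proof -
  have "\<bar>\<sigma> i\<bar> \<le> 1" if "i \<in> {1..N}" for i
  proof -
    have "\<sigma> i \<in> {-1, 1}" using assms that by (auto simp: spins_def)
    then show ?thesis by auto
  qed
  then have "\<bar>\<Sum>i=1..N. \<sigma> i\<bar> \<le> real N"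
    using sum_norm_bound[of "{1..N}" \<sigma> 1] by simp
  then have "(\<Sum>i=1..N. \<sigma> i)\<^sup>2 \<le> (real N)\<^sup>2" by (metis abs_le_square_iff abs_of_nat)
  then show "- real N / 2 \<le> ising_H N \<sigma>"
    by (cases "N = 0") (auto simp: ising_H_square divide_simps power2_eq_square)
  show "ising_H N \<sigma> \<le> 0" by (simp add: ising_H_square)
qed

lemma ising_gen_dirichlet:
  "(\<Sum>x\<in>spins N. ising_mu N t x * f x * mat_fun (spins N) (ising_gen N t) g x)
    = - (\<Sum>x\<in>spins N. \<Sum>y\<in>spins N. hypercube_kernel N x y * min (ising_mu N t x) (ising_mu N t y)
        * ((f x - f y) * (g x - g y))) / 2"
  unfolding ising_gen_def
  by (intro metropolis_dirichlet_form finite_spins ising_mu_pos hypercube_kernel_sym)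

definition ising_W :: "nat \<Rightarrow> real \<Rightarrow> nat \<Rightarrow> real" where
  "ising_W N t k = exp (t * (2 * real k - real N)\<^sup>2 / (2 * real N)) / (\<Sum>\<tau>\<in>spins N. exp (- t * ising_H N \<tau>))"

lemma ising_mu_conf:
  assumes "s \<in> {1, -1}" "A \<subseteq> {1..N}"
  shows "ising_mu N t (conf N s A) = ising_W N t (card A)"
    "ising_H N (conf N s A) = - (2 * real (card A) - real N)\<^sup>2 / (2 * real N)"
proof -
  have "s\<^sup>2 = 1" using assms by auto
  then show *: "ising_H N (conf N s A) = - (2 * real (card A) - real N)\<^sup>2 / (2 * real N)"
    by (simp only: ising_H_square sum_conf[OF assms(2)] power_mult_distrib mult_1)
  show "ising_mu N t (conf N s A) = ising_W N t (card A)"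
    by (simp add: ising_mu_eq[OF conf_in_spins[OF assms(1)]] * ising_W_def)
qed

text \<open>On adjacent levels \<open>2 * k - N\<close> takes the values \<open>2 * i + 1\<close>
  and \<open>2 * i + 3\<close>, whose squares differ by \<open>8 * (i + 1)\<close>; this determines
  \<open>q\<close>.\<close>

lemma half_cube_ising:
  assumes "t \<ge> 0"
  shows "half_cube {1..2 * n + 1} n (exp (- 4 * t / real (2 * n + 1))) (ising_W (2 * n + 1) t)"
proof
  show "0 < ising_W (2 * n + 1) t k" for k using ising_Z_pos by (simp add: ising_W_def)
  show "exp (- 4 * t / real (2 * n + 1)) \<le> 1" using assms by simp
  fix i
  define N where "N = real (2 * n + 1)"
  have N: "N > 0" by (simp add: N_def)
  have "t * (2 * real (n + 1 + i) - N)\<^sup>2 / (2 * N)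
     = t * (2 * real (n + 2 + i) - N)\<^sup>2 / (2 * N) + real (i + 1) * (- 4 * t / N)"
  proof -
    have "2 * real (n + 1 + i) - N = 2 * real i + 1" "2 * real (n + 2 + i) - N = 2 * real i + 3"
      by (auto simp: N_def)
    then show ?thesis using N by (simp only:) (simp add: field_simps power2_eq_square)
  qed
  then have "exp (t * (2 * real (n + 1 + i) - N)\<^sup>2 / (2 * N))
     = exp (t * (2 * real (n + 2 + i) - N)\<^sup>2 / (2 * N)) * exp (- 4 * t / N) ^ (i + 1)"
    by (simp only: exp_add exp_of_nat_mult)
  then show "ising_W (2 * n + 1) t (n + 1 + i)
     = ising_W (2 * n + 1) t (n + 2 + i) * exp (- 4 * t / real (2 * n + 1)) ^ (i + 1)"
    unfolding ising_W_def N_def[symmetric] by simp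
qed auto

text \<open>The weight increases with the majority, so the minimum is attained at the lower end of
  each edge. Every edge occurs in both orders, as \<open>up\<close> and \<open>dn\<close>, which
  cancels the factor \<open>1 / 2\<close>; \<open>1 / N\<close> is the proposal probability.\<close>

lemma half_dirichlet_le:
  assumes t: "t \<ge> 0" and s: "s \<in> {1, -1}" and N: "N = 2 * n + 1"
  shows "(\<Sum>A\<in>major n. \<Sum>i\<in>{1..N} - A. ising_W N t (card A) * (f (conf N s (insert i A)) - f (conf N s A))\<^sup>2) / real N
    \<le> (\<Sum>A\<in>major n. \<Sum>B\<in>major n. hypercube_kernel N (conf N s A) (conf N s B)
       * min (ising_W N t (card A)) (ising_W N t (card B)) * (f (conf N s A) - f (conf N s B))\<^sup>2) / 2"
proof -
  interpret half_cube "{1..N}" n "exp (- 4 * t / real N)" "ising_W N t"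
    unfolding N by (rule half_cube_ising[OF t])
  have X: "X = major n" unfolding X_def major_def by (simp only: N)
  define F where "F = (\<lambda>(A, B). hypercube_kernel N (conf N s A) (conf N s B)
       * min (ising_W N t (card A)) (ising_W N t (card B)) * (f (conf N s A) - f (conf N s B))\<^sup>2)"
  define E where "E = Sigma X (\<lambda>A. {1..N} - A)"
  define up where "up = (\<lambda>(A, i :: nat). (A, insert i A))"
  define dn where "dn = (\<lambda>(A, i :: nat). (insert i A, A))"
  have finE: "finite E" unfolding E_def using finX by (intro finite_SigmaI) auto
  have F_up: "F (up z) = (case z of (A, i) \<Rightarrow> ising_W N t (card A) * (f (conf N s (insert i A)) - f (conf N s A))\<^sup>2) / real N"
    and F_dn: "F (dn z) = F (up z)" if z: "z \<in> E" for z
  proof -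
    obtain A i where Ai: "z = (A, i)" "A \<in> X" "i \<in> {1..N} - A" using z by (auto simp: E_def)
    have c: "card A = n + 1 + lev A" "card (insert i A) = n + 2 + lev A"
      using X_D[OF Ai(2)] X_D(3)[OF insert_X(1)[OF Ai(2,3)]] insert_X(2)[OF Ai(2,3)] by auto
    have "ising_W N t (n + 2 + lev A) * exp (- 4 * t / real N) ^ (lev A + 1) \<le> ising_W N t (n + 2 + lev A)"
      using q Wpos[of "n + 2 + lev A"] by (intro mult_left_le power_le_one) auto
    then have "ising_W N t (card A) \<le> ising_W N t (card (insert i A))"
      unfolding c Wratio .
    then have mn: "min (ising_W N t (card A)) (ising_W N t (card (insert i A))) = ising_W N t (card A)" by simp
    have k: "hypercube_kernel N (conf N s A) (conf N s (insert i A)) = 1 / real N"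
      using Ai s by (intro hypercube_kernel_conf) auto
    show "F (up z) = (case z of (A, i) \<Rightarrow> ising_W N t (card A) * (f (conf N s (insert i A)) - f (conf N s A))\<^sup>2) / real N"
      by (simp add: F_def up_def Ai(1) mn k power2_commute)
    show "F (dn z) = F (up z)"
      by (simp add: F_def up_def dn_def Ai(1) hypercube_kernel_sym min.commute power2_commute)
  qed
  have inj_up: "inj_on up E" by (auto simp: inj_on_def up_def E_def)
  have inj_dn: "inj_on dn E" by (auto simp: inj_on_def dn_def E_def)
  have disj: "up ` E \<inter> dn ` E = {}" by (auto simp: up_def dn_def E_def)
  have sub: "up ` E \<union> dn ` E \<subseteq> X \<times> X" using insert_X by (auto simp: up_def dn_def E_def)
  have Fpos: "F z \<ge> 0" for z
    using Wpos by (auto simp: F_def hypercube_kernel_def less_imp_le split: prod.splits)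
  have "sum F (up ` E) + sum F (dn ` E) = sum F (up ` E \<union> dn ` E)"
    using finE disj by (intro sum.union_disjoint[symmetric]) auto
  also have "\<dots> \<le> sum F (X \<times> X)" using sub finX Fpos by (intro sum_mono2) auto
  finally have "2 * (\<Sum>z\<in>E. F (up z)) \<le> sum F (X \<times> X)"
    using F_dn by (simp add: sum.reindex[OF inj_up] sum.reindex[OF inj_dn])
  moreover have "(\<Sum>z\<in>E. F (up z))
     = (\<Sum>A\<in>X. \<Sum>i\<in>{1..N} - A. ising_W N t (card A) * (f (conf N s (insert i A)) - f (conf N s A))\<^sup>2) / real N"
  proof -
    have "(\<Sum>z\<in>E. F (up z)) = (\<Sum>(A,i)\<in>E. ising_W N t (card A) * (f (conf N s (insert i A)) - f (conf N s A))\<^sup>2) / real N"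
      unfolding sum_divide_distrib by (intro sum.cong) (auto simp: F_up)
    then show ?thesis unfolding E_def using finX by (subst sum.Sigma) auto
  qed
  moreover have "sum F (X \<times> X) = (\<Sum>A\<in>X. \<Sum>B\<in>X. F (A, B))" by (simp add: sum.cartesian_product)
  ultimately have "(\<Sum>A\<in>X. \<Sum>i\<in>{1..N} - A. ising_W N t (card A) * (f (conf N s (insert i A)) - f (conf N s A))\<^sup>2) / real N
    \<le> (\<Sum>A\<in>X. \<Sum>B\<in>X. F (A, B)) / 2" by linarith
  then show ?thesis by (simp only: X F_def prod.case)
qed

text \<open>Edges between the halves contribute nonnegative terms and are dropped, and within a half
  \<open>f\<close> and \<open>h\<close> have the same differences. Of the two factors
  \<open>N\<close>, one comes from the gap of the half cube and one from the proposal.\<close>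

lemma ising_local_poincare:
  assumes t: "t \<ge> 0" and N: "N = 2 * n + 1" 
    and mean: "\<And>s. s \<in> {1, -1} \<Longrightarrow> (\<Sum>A\<in>major n. ising_W N t (card A) * h (conf N s A)) = 0"
    and f: "\<And>s A. s \<in> {1, -1} \<Longrightarrow> A \<in> major n \<Longrightarrow> f (conf N s A) = s * c + h (conf N s A)"
  shows "(\<Sum>x\<in>spins N. ising_mu N t x * (h x)\<^sup>2)
    \<le> 9 * (real N)\<^sup>2 * - (\<Sum>x\<in>spins N. ising_mu N t x * f x * mat_fun (spins N) (ising_gen N t) f x)"
proof -
  interpret half_cube "{1..N}" n "exp (- 4 * t / real N)" "ising_W N t"
    unfolding N by (rule half_cube_ising[OF t])
  have X: "X = major n" unfolding X_def major_def by (simp only: N)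
  have sub: "A \<subseteq> {1..N}" if "A \<in> major n" for A using that by (auto simp: major_def N)
  have N0: "real N > 0" by (simp add: N)
  define D where "D s = (\<Sum>A\<in>major n. \<Sum>B\<in>major n. hypercube_kernel N (conf N s A) (conf N s B)
       * min (ising_W N t (card A)) (ising_W N t (card B)) * (f (conf N s A) - f (conf N s B))\<^sup>2)" for s
  have half: "(\<Sum>A\<in>major n. ising_W N t (card A) * (h (conf N s A))\<^sup>2) \<le> 9 * (real N)\<^sup>2 * (D s / 2)"
    if s: "s \<in> {1, -1}" for s
  proof -
    have "(\<Sum>A\<in>X. ising_W N t (card A) * (h (conf N s A))\<^sup>2)
      \<le> 9 * real N * (\<Sum>A\<in>X. \<Sum>i\<in>{1..N} - A. ising_W N t (card A) * (h (conf N s (insert i A)) - h (conf N s A))\<^sup>2)"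
      using poincare[of "\<lambda>A. h (conf N s A)"] mean[OF s] by (simp only: X N[symmetric])
    also have "(\<Sum>A\<in>X. \<Sum>i\<in>{1..N} - A. ising_W N t (card A) * (h (conf N s (insert i A)) - h (conf N s A))\<^sup>2)
       = (\<Sum>A\<in>X. \<Sum>i\<in>{1..N} - A. ising_W N t (card A) * (f (conf N s (insert i A)) - f (conf N s A))\<^sup>2)"
    proof (intro sum.cong refl)
      fix A i assume A: "A \<in> X" "i \<in> {1..N} - A"
      have "f (conf N s A) = s * c + h (conf N s A)"
        "f (conf N s (insert i A)) = s * c + h (conf N s (insert i A))"
        using f[OF s] A(1) insert_X(1)[OF A] unfolding X by blast+
      then show "ising_W N t (card A) * (h (conf N s (insert i A)) - h (conf N s A))\<^sup>2
          = ising_W N t (card A) * (f (conf N s (insert i A)) - f (conf N s A))\<^sup>2" by simp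
    qed
    also have "9 * real N * \<dots> = 9 * (real N)\<^sup>2 * (\<dots> / real N)"
      using N0 by (simp add: power2_eq_square)
    also have "\<dots> \<le> 9 * (real N)\<^sup>2 * (D s / 2)"
      using half_dirichlet_le[OF t s N, of f] unfolding D_def X
      by (intro mult_left_mono) auto
    finally show ?thesis unfolding X .
  qed
  define F where "F x y = hypercube_kernel N x y * min (ising_mu N t x) (ising_mu N t y) * ((f x - f y) * (f x - f y))" for x y
  have Fpos: "F x y \<ge> 0" if "x \<in> spins N" "y \<in> spins N" for x y
    using ising_mu_pos[OF that(1)] ising_mu_pos[OF that(2)]
    by (auto simp: F_def hypercube_kernel_def less_imp_le)
  have D: "D s = (\<Sum>A\<in>major n. \<Sum>B\<in>major n. F (conf N s A) (conf N s B))" if s: "s \<in> {1, -1}" for s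
    unfolding D_def F_def using sub ising_mu_conf(1)[OF s]
    by (intro sum.cong refl) (simp add: power2_eq_square)
  have split: "(\<Sum>\<sigma>\<in>spins N. g \<sigma>) = (\<Sum>A\<in>major n. g (conf N 1 A)) + (\<Sum>A\<in>major n. g (conf N (-1) A))" for g :: "(nat \<Rightarrow> real) \<Rightarrow> real"
    unfolding N by (rule spins_split)
  have "D 1 + D (-1) \<le> (\<Sum>x\<in>spins N. \<Sum>y\<in>spins N. F x y)"
  proof -
    have nn: "0 \<le> (\<Sum>A\<in>major n. \<Sum>B\<in>major n. F (conf N s A) (conf N r B))"
      if "s \<in> {1, -1}" "r \<in> {1, -1}" for s r
      using Fpos conf_in_spins that by (intro sum_nonneg) auto
    show ?thesis unfolding split sum.distrib using nn[of 1 "-1"] nn[of "-1" 1] by (simp add: D)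
  qed
  then have "9 * (real N)\<^sup>2 * ((D 1 + D (-1)) / 2) \<le> 9 * (real N)\<^sup>2 * ((\<Sum>x\<in>spins N. \<Sum>y\<in>spins N. F x y) / 2)"
    by (intro mult_left_mono divide_right_mono) auto
  moreover have "(\<Sum>x\<in>spins N. ising_mu N t x * (h x)\<^sup>2) \<le> 9 * (real N)\<^sup>2 * ((D 1 + D (-1)) / 2)"
    unfolding split using half[of 1] half[of "-1"] sub
    by (simp add: ising_mu_conf(1) add_divide_distrib distrib_left)
  ultimately have "(\<Sum>x\<in>spins N. ising_mu N t x * (h x)\<^sup>2)
    \<le> 9 * (real N)\<^sup>2 * ((\<Sum>x\<in>spins N. \<Sum>y\<in>spins N. F x y) / 2)" by linarith
  then show ?thesis unfolding ising_gen_dirichlet F_def by simp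
qed

section \<open>The drift of the chi-square distance at a fixed time\<close>

lemma weighted_cauchy_schwarz_bound:
  fixes w g h :: "'a \<Rightarrow> real"
  assumes w: "\<And>x. x \<in> S \<Longrightarrow> w x \<ge> 0" "(\<Sum>x\<in>S. w x) = 1"
    and g: "\<And>x. x \<in> S \<Longrightarrow> \<bar>g x\<bar> \<le> K" and K: "K \<ge> 0"
  shows "\<bar>\<Sum>x\<in>S. w x * g x * h x\<bar> \<le> K * sqrt (\<Sum>x\<in>S. w x * (h x)\<^sup>2)"
proof -
  have eq: "(\<Sum>x\<in>S. w x * g x * h x) = (\<Sum>x\<in>S. (sqrt (w x) * g x) * (sqrt (w x) * h x))"
  proof (rule sum.cong)
    fix x assume "x \<in> S"
    then have "w x = sqrt (w x) * sqrt (w x)" using w by simp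
    then show "w x * g x * h x = (sqrt (w x) * g x) * (sqrt (w x) * h x)"
      by (metis mult.assoc mult.left_commute)
  qed simp
  have sq: "(\<Sum>x\<in>S. (sqrt (w x) * g x)\<^sup>2) = (\<Sum>x\<in>S. w x * (g x)\<^sup>2)" for g
    using w by (intro sum.cong) (auto simp: power_mult_distrib)
  have "(\<Sum>x\<in>S. w x * (g x)\<^sup>2) \<le> (\<Sum>x\<in>S. w x * K\<^sup>2)"
    using w g K by (intro sum_mono mult_left_mono) (auto simp: abs_le_square_iff[symmetric])
  also have "\<dots> = K\<^sup>2" using w by (simp add: sum_distrib_right[symmetric])
  finally have gK: "(\<Sum>x\<in>S. w x * (g x)\<^sup>2) \<le> K\<^sup>2" .
  have h0: "(\<Sum>x\<in>S. w x * (h x)\<^sup>2) \<ge> 0" using w by (intro sum_nonneg) auto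
  have "(\<Sum>x\<in>S. w x * g x * h x)\<^sup>2 \<le> (\<Sum>x\<in>S. w x * (g x)\<^sup>2) * (\<Sum>x\<in>S. w x * (h x)\<^sup>2)"
    unfolding eq using Cauchy_Schwarz_ineq_sum[of "\<lambda>x. sqrt (w x) * g x" "\<lambda>x. sqrt (w x) * h x" S]
    by (simp only: sq)
  also have "\<dots> \<le> K\<^sup>2 * (\<Sum>x\<in>S. w x * (h x)\<^sup>2)" using gK h0 by (rule mult_right_mono)
  finally have "sqrt ((\<Sum>x\<in>S. w x * g x * h x)\<^sup>2) \<le> sqrt (K\<^sup>2 * (\<Sum>x\<in>S. w x * (h x)\<^sup>2))"
    by (rule real_sqrt_le_mono)
  then show ?thesis using K by (simp add: real_sqrt_mult)
qed

lemma ising_drift_bound: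
  assumes t: "t \<ge> 0" and N: "N = 2 * n + 1" and \<beta>: "\<beta> > 0"
    and m: "m \<ge> 9 / 4 * real N ^ 3 + 9 / 8 * \<beta> * real N ^ 4"
    and mean: "(\<Sum>x\<in>spins N. ising_mu N t x * f x) = 0"
  defines "\<epsilon> \<equiv> (\<Sum>x\<in>spins N. ising_mu N t x * (f x)\<^sup>2)"
    and "Hm \<equiv> (\<Sum>x\<in>spins N. ising_mu N t x * ising_H N x)"
  shows "2 * m * (\<Sum>x\<in>spins N. ising_mu N t x * f x * mat_fun (spins N) (ising_gen N t) f x)
      + 2 * (\<Sum>x\<in>spins N. ising_mu N t x * ising_H N x * f x) * \<epsilon>
      - (\<Sum>x\<in>spins N. ising_mu N t x * (ising_H N x - Hm) * (f x)\<^sup>2)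
    \<le> \<epsilon> * (1 + \<epsilon>) / (2 * \<beta>)"
proof -
  define S where "S = spins N"
  define \<mu> where "\<mu> = ising_mu N t"
  define H where "H = ising_H N"
  define \<sigma>g where "\<sigma>g x = sgn (\<Sum>i=1..N. x i)" for x :: "nat \<Rightarrow> real"
  define av where "av g = (\<Sum>x\<in>S. \<mu> x * g x)" for g
  define r where "r = real N"
  have r: "r \<ge> 1" by (simp add: r_def N)
  have \<mu>: "\<And>x. x \<in> S \<Longrightarrow> \<mu> x \<ge> 0" "(\<Sum>x\<in>S. \<mu> x) = 1"
    by (auto simp: S_def \<mu>_def ising_mu_pos less_imp_le sum_ising_mu)
  have sub: "A \<subseteq> {1..N}" if "A \<in> major n" for A using that by (auto simp: major_def N)
  have split: "av g = (\<Sum>A\<in>major n. ising_W N t (card A) * g (conf N 1 A))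
      + (\<Sum>A\<in>major n. ising_W N t (card A) * g (conf N (-1) A))" for g
  proof -
    have "av g = (\<Sum>A\<in>major n. \<mu> (conf N 1 A) * g (conf N 1 A))
      + (\<Sum>A\<in>major n. \<mu> (conf N (-1) A) * g (conf N (-1) A))"
      unfolding av_def S_def N by (rule spins_split)
    moreover have "\<mu> (conf N s A) = ising_W N t (card A)" if "A \<in> major n" "s \<in> {1, -1}" for A s
      unfolding \<mu>_def using ising_mu_conf(1) sub that by blast
    ultimately show ?thesis by simp
  qed
  have sgn_conf: "\<sigma>g (conf N s A) = s" if "s \<in> {1, -1}" "A \<in> major n" for s A
  proof -
    have "2 * real (card A) - real N > 0" using that(2) by (auto simp: major_def N)
    then show ?thesis unfolding \<sigma>g_def sum_conf[OF sub[OF that(2)]]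
      using that(1) by (auto simp: sgn_mult)
  qed
  have H_conf: "H (conf N 1 A) = H (conf N (-1) A)" if "A \<in> major n" for A
    unfolding H_def using ising_mu_conf(2)[OF _ sub[OF that]] by simp
  define \<omega> where "\<omega> = (\<Sum>A\<in>major n. ising_W N t (card A))"
  have "av (\<lambda>_. 1) = 1" using \<mu>(2) by (simp add: av_def)
  then have \<omega>: "\<omega> = 1 / 2" unfolding split by (simp add: \<omega>_def)
  define a where "a s = (\<Sum>A\<in>major n. ising_W N t (card A) * f (conf N s A))" for s
  have a: "a 1 + a (-1) = 0" using mean split[of f] by (simp add: a_def av_def \<mu>_def S_def)
  \<comment> \<open>Each half has mass \<open>1 / 2\<close>, so the conditional mean of
    \<open>f\<close> on the half with sign \<open>s\<close> is
    \<open>2 * a s = c * s\<close>.\<close>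
  define c where "c = 2 * a 1"
  define h where "h x = f x - c * \<sigma>g x" for x
  have f_h: "f x = c * \<sigma>g x + h x" for x by (simp add: h_def)
  have h0: "(\<Sum>A\<in>major n. ising_W N t (card A) * h (conf N s A)) = 0" if s: "s \<in> {1, -1}" for s
  proof -
    have "(\<Sum>A\<in>major n. ising_W N t (card A) * h (conf N s A))
       = (\<Sum>A\<in>major n. ising_W N t (card A) * f (conf N s A) - ising_W N t (card A) * (c * s))"
      using s by (intro sum.cong) (auto simp: h_def sgn_conf algebra_simps)
    also have "\<dots> = a s - \<omega> * (c * s)"
      by (simp add: sum_subtractf sum_distrib_right a_def \<omega>_def)
    also have "\<dots> = 0" using s a by (auto simp: \<omega> c_def)
    finally show ?thesis .
  qed
  have av_h: "av h = 0" unfolding split using h0 by simp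
  have av_sh: "av (\<lambda>x. \<sigma>g x * h x) = 0"
  proof -
    have "(\<Sum>A\<in>major n. ising_W N t (card A) * (\<sigma>g (conf N s A) * h (conf N s A)))
       = s * (\<Sum>A\<in>major n. ising_W N t (card A) * h (conf N s A))" if "s \<in> {1, -1}" for s
      unfolding sum_distrib_left using sgn_conf[OF that] by (intro sum.cong) auto
    from this[of 1] this[of "-1"] show ?thesis unfolding split using h0 by simp
  qed
  have av_sH: "av (\<lambda>x. \<sigma>g x * H x) = 0"
  proof -
    have "(\<Sum>A\<in>major n. ising_W N t (card A) * (\<sigma>g (conf N s A) * H (conf N s A)))
       = s * (\<Sum>A\<in>major n. ising_W N t (card A) * H (conf N 1 A))" if "s \<in> {1, -1}" for s
      unfolding sum_distrib_left using sgn_conf[OF that] that H_conf by (intro sum.cong) auto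
    from this[of 1] this[of "-1"] show ?thesis unfolding split by simp
  qed
  have sg2: "\<sigma>g x * \<sigma>g x = 1" if x: "x \<in> S" for x
  proof (rule ccontr)
    assume ne: "\<sigma>g x * \<sigma>g x \<noteq> 1"
    define g where "g y = (if \<sigma>g y * \<sigma>g y = 1 then 0 else 1 :: real)" for y
    have "(\<Sum>y\<in>S. g y) = 0"
      unfolding S_def N spins_split using sgn_conf unfolding g_def N by simp
    moreover have "(\<Sum>y\<in>S. g y) > 0"
      using x ne finite_spins by (intro sum_pos2[of _ x]) (auto simp: g_def S_def)
    ultimately show False by simp
  qed
  have av_add: "av (\<lambda>x. g x + k x) = av g + av k" and av_cm: "av (\<lambda>x. z * g x) = z * av g" for g k z
    by (auto simp: av_def sum.distrib[symmetric] sum_distrib_left algebra_simps)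
  have av_cong: "av g = av k" if "\<And>x. x \<in> S \<Longrightarrow> g x = k x" for g k
    using that by (simp add: av_def)
  define v where "v = av (\<lambda>x. (h x)\<^sup>2)"
  have v0: "v \<ge> 0" unfolding v_def av_def using \<mu> by (intro sum_nonneg) auto
  \<comment> \<open>Centring at the midpoint of the range \<open>[-N / 2, 0]\<close> halves the
    supremum. The pairings with \<open>h\<close> and with \<open>\<sigma>g * h\<close> do not
    change, because \<open>h\<close> has mean zero on each half.\<close>
  define Hc where "Hc x = H x + r / 4" for x
  have Hc: "\<bar>Hc x\<bar> \<le> r / 4" if "x \<in> S" for x
    using ising_H_bounds[of x N] that unfolding Hc_def H_def S_def r_def by linarith
  have \<epsilon>: "\<epsilon> = c\<^sup>2 + v"
  proof -
    have "\<epsilon> = av (\<lambda>x. (f x)\<^sup>2)" by (simp add: \<epsilon>_def av_def S_def \<mu>_def)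
    also have "\<dots> = av (\<lambda>x. c\<^sup>2 * 1 + (2 * c * (\<sigma>g x * h x) + (h x)\<^sup>2))"
    proof (rule av_cong)
      fix x assume "x \<in> S"
      have "(f x)\<^sup>2 = c\<^sup>2 * (\<sigma>g x * \<sigma>g x) + (2 * c * (\<sigma>g x * h x) + (h x)\<^sup>2)"
        by (simp add: f_h power2_eq_square algebra_simps)
      then show "(f x)\<^sup>2 = c\<^sup>2 * 1 + (2 * c * (\<sigma>g x * h x) + (h x)\<^sup>2)" using sg2[OF \<open>x \<in> S\<close>] by simp
    qed
    also have "\<dots> = c\<^sup>2 + v" unfolding av_add av_cm av_sh v_def using \<open>av (\<lambda>_. 1) = 1\<close> by simp
    finally show ?thesis .
  qed
  have Hf: "av (\<lambda>x. H x * f x) = av (\<lambda>x. Hc x * h x)"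
  proof -
    have "av (\<lambda>x. H x * f x) = av (\<lambda>x. c * (\<sigma>g x * H x) + (Hc x * h x + (- (r / 4)) * h x))"
      by (rule av_cong) (simp add: f_h Hc_def algebra_simps)
    then show ?thesis unfolding av_add av_cm av_sH av_h by simp
  qed
  have Hm: "Hm = av H" by (simp add: Hm_def av_def S_def \<mu>_def H_def)
  have Hff: "av (\<lambda>x. (H x - Hm) * (f x)\<^sup>2)
     = 2 * c * av (\<lambda>x. Hc x * (\<sigma>g x * h x)) + av (\<lambda>x. (H x - Hm) * (h x)\<^sup>2)"
  proof -
    have "av (\<lambda>x. (H x - Hm) * (f x)\<^sup>2)
      = av (\<lambda>x. c\<^sup>2 * (H x + (- Hm) * 1) + (2 * c * (Hc x * (\<sigma>g x * h x) + (- Hm - r / 4) * (\<sigma>g x * h x))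
           + (H x - Hm) * (h x)\<^sup>2))"
    proof (rule av_cong)
      fix x assume "x \<in> S"
      have "(f x)\<^sup>2 = c\<^sup>2 * (\<sigma>g x * \<sigma>g x) + (2 * c * (\<sigma>g x * h x) + (h x)\<^sup>2)"
        by (simp add: f_h power2_eq_square algebra_simps)
      then have "(f x)\<^sup>2 = c\<^sup>2 + (2 * c * (\<sigma>g x * h x) + (h x)\<^sup>2)" using sg2[OF \<open>x \<in> S\<close>] by simp
      then show "(H x - Hm) * (f x)\<^sup>2
        = c\<^sup>2 * (H x + (- Hm) * 1) + (2 * c * (Hc x * (\<sigma>g x * h x) + (- Hm - r / 4) * (\<sigma>g x * h x))
           + (H x - Hm) * (h x)\<^sup>2)"
        by (simp add: Hc_def algebra_simps)
    qed
    then show ?thesis unfolding av_add av_cm av_sh using \<open>av (\<lambda>_. 1) = 1\<close> Hm by simp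
  qed
  have cs1: "\<bar>av (\<lambda>x. Hc x * h x)\<bar> \<le> r / 4 * sqrt v"
    using weighted_cauchy_schwarz_bound[OF \<mu> Hc, where h = h] r
    unfolding av_def v_def by (simp add: mult.assoc)
  have "\<bar>Hc x * \<sigma>g x\<bar> \<le> r / 4" if "x \<in> S" for x
  proof -
    have "\<bar>\<sigma>g x\<bar> \<le> 1" by (simp add: \<sigma>g_def sgn_if)
    then have "\<bar>Hc x\<bar> * \<bar>\<sigma>g x\<bar> \<le> r / 4 * 1" using Hc[OF that] by (intro mult_mono) auto
    then show ?thesis by (simp add: abs_mult)
  qed
  then have cs2: "\<bar>av (\<lambda>x. Hc x * (\<sigma>g x * h x))\<bar> \<le> r / 4 * sqrt v"
    using weighted_cauchy_schwarz_bound[OF \<mu>, where g = "\<lambda>x. Hc x * \<sigma>g x" and K = "r / 4" and h = h] r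
    unfolding av_def v_def by (simp add: mult.assoc)
  have low: "av (\<lambda>x. (H x - Hm) * (h x)\<^sup>2) \<ge> - (r / 2) * v"
  proof -
    have "Hm \<le> 0" unfolding Hm av_def using \<mu> ising_H_bounds(2)
      by (intro sum_nonpos mult_nonneg_nonpos) (auto simp: H_def S_def)
    then have "- (r / 2) \<le> H x - Hm" if "x \<in> S" for x
      using ising_H_bounds(1)[of x N] that by (auto simp: H_def S_def r_def)
    then show ?thesis unfolding v_def av_cm[symmetric] unfolding av_def using \<mu>
      by (intro sum_mono mult_left_mono mult_right_mono) auto
  qed
  define E where "E = - (\<Sum>x\<in>S. \<mu> x * f x * mat_fun S (ising_gen N t) f x)"
  have poinc: "v \<le> 9 * r\<^sup>2 * E"
    using ising_local_poincare[OF t N h0, of f c] f_h sgn_conf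
    unfolding v_def av_def E_def S_def \<mu>_def r_def by (simp add: mult.commute)
  have E0: "E \<ge> 0"
  proof -
    have "0 \<le> 9 * r\<^sup>2 * E" using v0 poinc by linarith
    then show ?thesis using r by (simp add: zero_le_mult_iff)
  qed
  \<comment> \<open>Doubled and divided by \<open>9 * r^2\<close>, the threshold on \<open>m\<close>
    is \<open>r / 2 + \<beta> * r^2 / 4\<close>. The first summand cancels the bound
    \<open>low\<close>, the second is spent in \<open>sq\<close>.\<close>
  have mE: "2 * m * E \<ge> (r / 2 + \<beta> * r\<^sup>2 / 4) * v"
  proof -
    have "(r / 2 + \<beta> * r\<^sup>2 / 4) * v \<le> (r / 2 + \<beta> * r\<^sup>2 / 4) * (9 * r\<^sup>2 * E)"
      using poinc r \<beta> by (intro mult_left_mono) auto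
    also have "\<dots> = 2 * (9 / 4 * r ^ 3 + 9 / 8 * \<beta> * r ^ 4) * E"
      by (simp add: algebra_simps power2_eq_square power3_eq_cube power4_eq_xxxx)
    also have "\<dots> \<le> 2 * m * E" using m E0 unfolding r_def by (intro mult_right_mono) auto
    finally show ?thesis .
  qed
  define y where "y = sqrt v"
  have y: "y \<ge> 0" "y\<^sup>2 = v" using v0 by (auto simp: y_def)
  have e0: "\<epsilon> \<ge> 0" using \<epsilon> v0 by simp
  have 1: "2 * av (\<lambda>x. Hc x * h x) * \<epsilon> \<le> r / 2 * y * \<epsilon>"
  proof -
    have "av (\<lambda>x. Hc x * h x) * \<epsilon> \<le> (r / 4 * y) * \<epsilon>"
      using cs1 e0 unfolding y_def by (intro mult_right_mono) auto
    then show ?thesis by simp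
  qed
  have 2: "- (2 * c * av (\<lambda>x. Hc x * (\<sigma>g x * h x))) \<le> r / 2 * y * \<bar>c\<bar>"
  proof -
    have "\<bar>c * av (\<lambda>x. Hc x * (\<sigma>g x * h x))\<bar> \<le> \<bar>c\<bar> * (r / 4 * y)"
      unfolding abs_mult y_def using cs2 by (intro mult_left_mono) auto
    then show ?thesis by (simp add: mult.assoc mult.commute mult.left_commute abs_le_iff)
  qed
  \<comment> \<open>Completing the square leaves
    \<open>(\<epsilon> + |c|)^2 / (4 * \<beta>)\<close>. By
    \<open>(\<epsilon> + |c|)^2 \<le> 2 * (\<epsilon>^2 + c^2)\<close> and
    \<open>c^2 \<le> \<epsilon>\<close>, the latter from orthogonality of the decomposition, this is
    at most the right side.\<close>
  have sq: "- (\<beta> * r\<^sup>2 / 4 * v) + r / 2 * y * (\<epsilon> + \<bar>c\<bar>) \<le> \<epsilon> * (1 + \<epsilon>) / (2 * \<beta>)"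
  proof -
    define X where "X = r * y / 2"
    have "0 \<le> (2 * \<beta> * X - (\<epsilon> + \<bar>c\<bar>))\<^sup>2" by simp
    then have "4 * \<beta> * (- \<beta> * X\<^sup>2 + X * (\<epsilon> + \<bar>c\<bar>)) \<le> (\<epsilon> + \<bar>c\<bar>)\<^sup>2"
      by (simp add: power2_eq_square algebra_simps)
    also have "\<dots> \<le> 2 * (\<epsilon>\<^sup>2 + c\<^sup>2)"
      using zero_le_power2[of "\<epsilon> - \<bar>c\<bar>"] by (simp add: power2_sum power2_diff)
    also have "\<dots> \<le> 2 * (\<epsilon> * (1 + \<epsilon>))" using \<epsilon> v0 by (simp add: power2_eq_square algebra_simps)
    finally have "- \<beta> * X\<^sup>2 + X * (\<epsilon> + \<bar>c\<bar>) \<le> \<epsilon> * (1 + \<epsilon>) / (2 * \<beta>)"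
      using \<beta> by (simp add: field_simps)
    moreover have "\<beta> * X\<^sup>2 = \<beta> * r\<^sup>2 / 4 * v" by (simp add: X_def y(2)[symmetric] power2_eq_square)
    moreover have "X * (\<epsilon> + \<bar>c\<bar>) = r / 2 * y * (\<epsilon> + \<bar>c\<bar>)" by (simp add: X_def)
    ultimately show ?thesis by linarith
  qed
  have "2 * m * - E + 2 * av (\<lambda>x. H x * f x) * \<epsilon> - av (\<lambda>x. (H x - Hm) * (f x)\<^sup>2)
     \<le> \<epsilon> * (1 + \<epsilon>) / (2 * \<beta>)"
    unfolding Hf Hff using mE low 1 2 sq by (simp add: distrib_left distrib_right)
  then show ?thesis by (simp add: E_def av_def S_def \<mu>_def H_def mult.assoc)
qed

section \<open>The evolution of the chi-square distance\<close>

text \<open>The derivative is controlled only on the open interval, where the threshold on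
  \<open>M\<close> is available; continuity takes the estimate to the end points.\<close>

lemma gronwall_differential:
  fixes u :: "real \<Rightarrow> real"
  assumes der: "\<And>t. 0 < t \<Longrightarrow> t < \<beta> \<Longrightarrow> \<exists>u'. (u has_real_derivative u') (at t) \<and> u' \<le> K * u t"
    and cont: "continuous_on {0..\<beta>} u" and t: "0 \<le> t" "t \<le> \<beta>"
  shows "u t \<le> exp (K * t) * u 0"
proof (cases "t = 0")
  case True then show ?thesis by simp
next
  case False
  define v where "v s = exp (- K * s) * u s" for s
  have "v t \<le> v 0"
  proof (rule DERIV_nonpos_imp_decreasing_open[of 0 t v])
    show "0 \<le> t" using t by simp
    show "continuous_on {0..t} v" unfolding v_def
      using t by (intro continuous_intros continuous_on_subset[OF cont]) auto
    fix s assume s: "0 < s" "s < t"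
    then obtain u' where u': "(u has_real_derivative u') (at s)" "u' \<le> K * u s"
      using der[of s] t by auto
    have "(v has_real_derivative exp (- K * s) * (u' - K * u s)) (at s)"
      unfolding v_def using u'(1) by (auto intro!: derivative_eq_intros simp: algebra_simps)
    moreover have "exp (- K * s) * (u' - K * u s) \<le> 0" using u'(2) by (simp add: mult_nonneg_nonpos)
    ultimately show "\<exists>y. (v has_real_derivative y) (at s) \<and> y \<le> 0" by blast
  qed
  then have "exp (K * t) * (exp (- K * t) * u t) \<le> exp (K * t) * u 0"
    by (intro mult_left_mono) (auto simp: v_def)
  then show ?thesis by (simp add: mult.assoc[symmetric] exp_add[symmetric])
qed

text \<open>Squaring removes the kink of the negative part at zero, which makes it accessible to an
  energy estimate.\<close>

lemma min_zero_square_deriv: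
  "((\<lambda>x :: real. (min x 0)\<^sup>2) has_real_derivative 2 * min x 0) (at x)"
proof (cases x "0 :: real" rule: linorder_cases)
  case less
  have "((\<lambda>x :: real. x\<^sup>2) has_real_derivative 2 * min x 0) (at x)"
    using less by (auto intro!: derivative_eq_intros)
  then show ?thesis
  proof (rule has_field_derivative_transform_within_open[where S = "{..<0}"])
    show "y\<^sup>2 = (min y 0)\<^sup>2" if "y \<in> {..<0}" for y :: real using that by (simp add: min_def)
  qed (use less in auto)
next
  case greater
  have "((\<lambda>x :: real. 0) has_real_derivative 2 * min x 0) (at x)"
    using greater by (auto intro!: derivative_eq_intros)
  then show ?thesis
  proof (rule has_field_derivative_transform_within_open[where S = "{0<..}"])
    show "0 = (min y 0)\<^sup>2" if "y \<in> {0<..}" for y :: real using that by (simp add: min_def)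
  qed (use greater in auto)
next
  case equal
  have "((\<lambda>h :: real. (min h 0)\<^sup>2 / h) \<longlongrightarrow> 0) (at 0)"
  proof (rule Lim_null_comparison)
    show "\<forall>\<^sub>F h in at 0. norm ((min h 0)\<^sup>2 / h) \<le> \<bar>h :: real\<bar>"
      by (auto intro!: always_eventually simp: min_def power2_eq_square)
    show "((\<lambda>h :: real. \<bar>h\<bar>) \<longlongrightarrow> 0) (at 0)" by (intro tendsto_eq_intros) auto
  qed
  then show ?thesis using equal by (simp add: DERIV_def)
qed

section \<open>The flow of the unnormalised measure\<close>

lemma metropolis_gen_const: "finite S \<Longrightarrow> x \<in> S \<Longrightarrow> (\<Sum>y\<in>S. metropolis_gen S K \<pi> x y) = 0"
proof -
  assume S: "finite S" "x \<in> S"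
  have "(\<Sum>y\<in>S - {x}. metropolis_gen S K \<pi> x y) = (\<Sum>y\<in>S - {x}. K x y * min (\<pi> y / \<pi> x) 1)"
    by (intro sum.cong) (auto simp: metropolis_gen_def)
  then show ?thesis using S by (simp add: sum.remove[of S x] metropolis_gen_def)
qed

text \<open>The propagator equation, applied to the indicator of \<open>y\<close>, becomes the
  forward equation for the weight at \<open>y\<close>.\<close>

lemma propagated_measure_deriv:
  assumes ev: "is_propagator S M L H p" and S: "finite S" and t: "t \<ge> 0" and y: "y \<in> S"
  shows "((\<lambda>u. meas_mat S \<nu> (p 0 u) y) has_real_derivative
      M t * (\<Sum>z\<in>S. meas_mat S \<nu> (p 0 t) z * L t z y) - H y * meas_mat S \<nu> (p 0 t) y) (at t within {0..})"
    and "meas_mat S \<nu> (p 0 0) y = \<nu> y"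
proof -
  define \<delta> where "\<delta> z = (if z = y then 1 else 0 :: real)" for z
  have \<delta>: "mat_fun S A \<delta> x = A x y" for A x
    using S y by (simp add: mat_fun_def \<delta>_def if_distrib cong: if_cong)
  have "((\<lambda>u. \<nu> x * mat_fun S (p 0 u) \<delta> x) has_real_derivative
      \<nu> x * mat_fun S (p 0 t) (\<lambda>z. M t * mat_fun S (L t) \<delta> z - H z * \<delta> z) x) (at t within {0..})"
    if "x \<in> S" for x
    using ev t that unfolding is_propagator_def by (intro DERIV_cmult) auto
  then have "((\<lambda>u. \<Sum>x\<in>S. \<nu> x * p 0 u x y) has_real_derivative
      (\<Sum>x\<in>S. \<nu> x * mat_fun S (p 0 t) (\<lambda>z. M t * L t z y - H z * \<delta> z) x)) (at t within {0..})"
    unfolding \<delta> by (intro DERIV_sum)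
  also have "(\<Sum>x\<in>S. \<nu> x * mat_fun S (p 0 t) (\<lambda>z. M t * L t z y - H z * \<delta> z) x)
     = (\<Sum>x\<in>S. \<Sum>z\<in>S. \<nu> x * p 0 t x z * (M t * L t z y - H z * \<delta> z))"
    by (simp add: mat_fun_def sum_distrib_left mult.assoc)
  also have "\<dots> = (\<Sum>z\<in>S. meas_mat S \<nu> (p 0 t) z * (M t * L t z y - H z * \<delta> z))"
    by (subst sum.swap) (simp add: meas_mat_def sum_distrib_right)
  also have "\<dots> = (\<Sum>z\<in>S. M t * (meas_mat S \<nu> (p 0 t) z * L t z y) - meas_mat S \<nu> (p 0 t) z * H z * \<delta> z)"
    by (intro sum.cong) (auto simp: algebra_simps)
  also have "\<dots> = M t * (\<Sum>z\<in>S. meas_mat S \<nu> (p 0 t) z * L t z y) - H y * meas_mat S \<nu> (p 0 t) y"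
  proof -
    have "(\<Sum>z\<in>S. meas_mat S \<nu> (p 0 t) z * H z * \<delta> z) = H y * meas_mat S \<nu> (p 0 t) y"
      using S y by (simp add: \<delta>_def if_distrib cong: if_cong)
    then show ?thesis by (simp add: sum_subtractf sum_distrib_left)
  qed
  finally show "((\<lambda>u. meas_mat S \<nu> (p 0 u) y) has_real_derivative
      M t * (\<Sum>z\<in>S. meas_mat S \<nu> (p 0 t) z * L t z y) - H y * meas_mat S \<nu> (p 0 t) y) (at t within {0..})"
    by (simp add: meas_mat_def)
  have "p 0 0 x y = \<delta> x" if "x \<in> S" for x
    using ev that \<delta>[of "p 0 0" x] unfolding is_propagator_def by (metis order_refl)
  then have "meas_mat S \<nu> (p 0 0) y = (\<Sum>x\<in>S. \<nu> x * \<delta> x)" by (simp add: meas_mat_def)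
  then show "meas_mat S \<nu> (p 0 0) y = \<nu> y"
    using S y by (simp add: \<delta>_def if_distrib cong: if_cong)
qed

text \<open>The function \<open>m\<close> stands for the unnormalised measure \<nu> propagated from
  time zero, known only through its differential equation and its initial value.\<close>

locale ising_flow =
  fixes N n :: nat and \<beta> :: real and M :: "real \<Rightarrow> real" and m :: "real \<Rightarrow> (nat \<Rightarrow> real) \<Rightarrow> real"
  assumes N: "N = 2 * n + 1" and \<beta>: "\<beta> > 0"
    and M0: "\<And>t. 0 < t \<Longrightarrow> t < \<beta> \<Longrightarrow> M t \<ge> 9 / 4 * real N ^ 3 + 9 / 8 * \<beta> * real N ^ 4"
    and m_deriv: "\<And>t y. t \<ge> 0 \<Longrightarrow> y \<in> spins N \<Longrightarrow> ((\<lambda>u. m u y) has_real_derivative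
      M t * (\<Sum>z\<in>spins N. m t z * ising_gen N t z y) - ising_H N y * m t y) (at t within {0..})"
    and m_init: "\<And>y. y \<in> spins N \<Longrightarrow> m 0 y \<ge> 0" "(\<Sum>y\<in>spins N. m 0 y) = 1"
begin

abbreviation "S \<equiv> spins N"
abbreviation "H \<equiv> ising_H N"
abbreviation "L \<equiv> ising_gen N"
abbreviation "\<mu> \<equiv> ising_mu N"

text \<open>The partition function up to the constant weight of the uniform distribution, which
  cancels in \<open>\<mu>\<close>.\<close>

definition W :: "real \<Rightarrow> real" where "W t = (\<Sum>y\<in>S. exp (- t * H y))"
definition Z :: "real \<Rightarrow> real" where "Z t = (\<Sum>y\<in>S. m t y)"

definition dm :: "real \<Rightarrow> (nat \<Rightarrow> real) \<Rightarrow> real" where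
  "dm t y = M t * (\<Sum>z\<in>S. m t z * L t z y) - H y * m t y"

lemma M_nonneg: "0 < t \<Longrightarrow> t < \<beta> \<Longrightarrow> M t \<ge> 0"
  using M0[of t] \<beta> by (smt (verit) divide_nonneg_nonneg mult_nonneg_nonneg of_nat_0_le_iff zero_le_power)

lemma m_cont: "y \<in> S \<Longrightarrow> continuous_on {0..\<beta>} (\<lambda>t. m t y)"
  unfolding continuous_on_eq_continuous_within
proof
  fix t assume "y \<in> S" "t \<in> {0..\<beta>}"
  then have "continuous (at t within {0..}) (\<lambda>t. m t y)"
    using m_deriv[of t y] DERIV_continuous by auto
  then show "continuous (at t within {0..\<beta>}) (\<lambda>t. m t y)"
    by (rule continuous_within_subset) auto
qed

lemma m_DERIV: "t > 0 \<Longrightarrow> y \<in> S \<Longrightarrow> ((\<lambda>u. m u y) has_real_derivative dm t y) (at t)"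
proof -
  assume t: "t > 0" and y: "y \<in> S"
  have "at t within {0..} = at t" using t by (intro at_within_interior) simp
  then show ?thesis using m_deriv[of t y] t y by (simp add: dm_def)
qed

lemma W_pos: "W t > 0" unfolding W_def using ising_Z_pos by simp

lemma \<mu>_W: "y \<in> S \<Longrightarrow> exp (- t * H y) = W t * \<mu> t y"
  using W_pos[of t] by (simp add: ising_mu_eq W_def)

lemma dm_test: "(\<Sum>y\<in>S. dm t y * f y) = M t * (\<Sum>z\<in>S. m t z * mat_fun S (L t) f z) - (\<Sum>y\<in>S. H y * m t y * f y)"
proof -
  have "(\<Sum>y\<in>S. (\<Sum>z\<in>S. m t z * L t z y) * f y) = (\<Sum>z\<in>S. m t z * mat_fun S (L t) f z)"
    unfolding mat_fun_def sum_distrib_right sum_distrib_left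
    by (subst sum.swap) (simp add: mult.assoc)
  moreover have "(\<Sum>y\<in>S. dm t y * f y) = (\<Sum>y\<in>S. M t * ((\<Sum>z\<in>S. m t z * L t z y) * f y) - H y * m t y * f y)"
    by (intro sum.cong) (auto simp: dm_def algebra_simps)
  ultimately show ?thesis by (simp add: sum_subtractf sum_distrib_left[symmetric])
qed

text \<open>An energy estimate. Since \<open>exp (t * H)\<close> is \<open>1 / \<mu> t\<close> up to
  the factor \<open>W t\<close>, \<open>u\<close> measures the negative part in the norm natural for
  the generator. The Dirichlet form of \<open>G\<close> with its negative part has the good sign,
  because truncation is monotone. The potential gives \<open>- 2 * H\<close> from the evolution and
  \<open>H\<close> from the weight, a net rate of at most \<open>N / 2\<close>. As \<open>u\<close>
  starts at zero, it stays zero.\<close>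

lemma m_nonneg: assumes t: "0 \<le> t" "t \<le> \<beta>" and y: "y \<in> S" shows "m t y \<ge> 0"
proof -
  define u where "u t = (\<Sum>y\<in>S. exp (t * H y) * (min (m t y) 0)\<^sup>2)" for t
  have "u t \<le> exp (real N / 2 * t) * u 0"
  proof (rule gronwall_differential[where \<beta> = \<beta> and u = u])
    show "continuous_on {0..\<beta>} u" unfolding u_def
      by (intro continuous_intros m_cont) auto
    fix s assume s: "0 < s" "s < \<beta>"
    define G where "G y = exp (s * H y) * m s y" for y
    define Gm where "Gm y = min (G y) 0" for y
    have Gm: "Gm y = exp (s * H y) * min (m s y) 0" for y
      unfolding Gm_def G_def by (auto simp: min_def mult_le_0_iff)
    have m_G: "m s y = W s * (\<mu> s y * G y)" if "y \<in> S" for y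
    proof -
      have "m s y = exp (- s * H y) * G y"
        by (simp add: G_def mult.assoc[symmetric] exp_add[symmetric])
      then show ?thesis using \<mu>_W[OF that, of s] by (simp only: mult.assoc)
    qed
    define u' where "u' = (\<Sum>y\<in>S. exp (s * H y) * (2 * min (m s y) 0 * dm s y) + H y * exp (s * H y) * (min (m s y) 0)\<^sup>2)"
    have "(u has_real_derivative u') (at s)"
      unfolding u_def u'_def
    proof (intro DERIV_sum)
      fix y assume y: "y \<in> S"
      have 1: "((\<lambda>t. (min (m t y) 0)\<^sup>2) has_real_derivative 2 * min (m s y) 0 * dm s y) (at s)"
        using DERIV_chain2[OF min_zero_square_deriv m_DERIV[OF s(1) y]] by simp
      show "((\<lambda>t. exp (t * H y) * (min (m t y) 0)\<^sup>2) has_real_derivative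
         exp (s * H y) * (2 * min (m s y) 0 * dm s y) + H y * exp (s * H y) * (min (m s y) 0)\<^sup>2) (at s)"
        by (rule derivative_eq_intros 1 refl)+ (simp add: algebra_simps)
    qed
    moreover have "u' \<le> real N / 2 * u s"
    proof -
      have "u' = 2 * (\<Sum>y\<in>S. dm s y * Gm y) + (\<Sum>y\<in>S. H y * exp (s * H y) * (min (m s y) 0)\<^sup>2)"
        unfolding u'_def Gm sum_distrib_left sum.distrib[symmetric]
        by (intro sum.cong) (auto simp: algebra_simps)
      also have "\<dots> = 2 * M s * (\<Sum>z\<in>S. m s z * mat_fun S (L s) Gm z) - 2 * (\<Sum>y\<in>S. H y * m s y * Gm y)
          + (\<Sum>y\<in>S. H y * exp (s * H y) * (min (m s y) 0)\<^sup>2)"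
        unfolding dm_test by (simp add: algebra_simps)
      also have "(\<Sum>y\<in>S. H y * m s y * Gm y) = (\<Sum>y\<in>S. H y * exp (s * H y) * (min (m s y) 0)\<^sup>2)"
        by (intro sum.cong) (auto simp: Gm min_def power2_eq_square)
      finally have u': "u' = 2 * M s * (\<Sum>z\<in>S. m s z * mat_fun S (L s) Gm z)
         - (\<Sum>y\<in>S. H y * exp (s * H y) * (min (m s y) 0)\<^sup>2)" by simp
      have "(\<Sum>z\<in>S. m s z * mat_fun S (L s) Gm z) = W s * (\<Sum>z\<in>S. \<mu> s z * G z * mat_fun S (L s) Gm z)"
        unfolding sum_distrib_left by (intro sum.cong) (auto simp: m_G)
      also have "\<dots> \<le> 0"
      proof -
        have "0 \<le> (\<Sum>x\<in>S. \<Sum>y\<in>S. hypercube_kernel N x y * min (\<mu> s x) (\<mu> s y)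
            * ((G x - G y) * (Gm x - Gm y)))"
        proof (intro sum_nonneg)
          fix x y assume xy: "x \<in> S" "y \<in> S"
          have "0 \<le> hypercube_kernel N x y" by (simp add: hypercube_kernel_def)
          moreover have "0 \<le> min (\<mu> s x) (\<mu> s y)" using ising_mu_pos xy by (simp add: less_imp_le)
          moreover have "0 \<le> (G x - G y) * (Gm x - Gm y)"
            by (auto simp: Gm_def min_def zero_le_mult_iff)
          ultimately show "0 \<le> hypercube_kernel N x y * min (\<mu> s x) (\<mu> s y)
            * ((G x - G y) * (Gm x - Gm y))" by (metis mult_nonneg_nonneg)
        qed
        then show ?thesis unfolding ising_gen_dirichlet using W_pos[of s] by (simp add: mult_nonneg_nonpos)
      qed
      finally have "2 * M s * (\<Sum>z\<in>S. m s z * mat_fun S (L s) Gm z) \<le> 0"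
        using M_nonneg[OF s] by (simp add: mult_nonneg_nonpos)
      moreover have "- (\<Sum>y\<in>S. H y * exp (s * H y) * (min (m s y) 0)\<^sup>2) \<le> real N / 2 * u s"
        unfolding u_def sum_negf[symmetric] sum_distrib_left
      proof (rule sum_mono)
        fix y assume y: "y \<in> S"
        have "(- H y) * (exp (s * H y) * (min (m s y) 0)\<^sup>2) \<le> real N / 2 * (exp (s * H y) * (min (m s y) 0)\<^sup>2)"
          using ising_H_bounds(1)[OF y] by (intro mult_right_mono) auto
        then show "- (H y * exp (s * H y) * (min (m s y) 0)\<^sup>2) \<le> real N / 2 * (exp (s * H y) * (min (m s y) 0)\<^sup>2)"
          by (simp add: mult.assoc)
      qed
      ultimately show ?thesis unfolding u' by linarith
    qed
    ultimately show "\<exists>u'. (u has_real_derivative u') (at s) \<and> u' \<le> real N / 2 * u s" by blast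
  qed (use t in auto)
  also have "u 0 = 0" unfolding u_def using m_init(1) by (intro sum.neutral) (simp add: min_absorb2)
  finally have "u t \<le> 0" by simp
  moreover have "exp (t * H y) * (min (m t y) 0)\<^sup>2 \<le> u t"
    unfolding u_def using y finite_spins by (intro member_le_sum) auto
  ultimately have "exp (t * H y) * (min (m t y) 0)\<^sup>2 \<le> 0" by linarith
  then have "(min (m t y) 0)\<^sup>2 \<le> 0" by (simp add: mult_le_0_iff)
  then show ?thesis by (simp add: min_def split: if_splits)
qed

lemma Z_DERIV: "t > 0 \<Longrightarrow> (Z has_real_derivative - (\<Sum>y\<in>S. H y * m t y)) (at t)"
proof -
  assume t: "t > 0"
  have "mat_fun S (L t) (\<lambda>_. 1) z = 0" if "z \<in> S" for z
    using metropolis_gen_const[OF finite_spins that] by (simp add: mat_fun_def ising_gen_def)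
  then have "(\<Sum>y\<in>S. dm t y) = - (\<Sum>y\<in>S. H y * m t y)"
    using dm_test[of t "\<lambda>_. 1"] by simp
  moreover have "(Z has_real_derivative (\<Sum>y\<in>S. dm t y)) (at t)"
    unfolding Z_def using m_DERIV[OF t] by (intro DERIV_sum) auto
  ultimately show ?thesis by simp
qed

lemma Z_cont: "continuous_on {0..\<beta>} Z"
  unfolding Z_def by (intro continuous_intros m_cont) auto

text \<open>As \<open>H \<le> 0\<close> and \<open>m\<close> is nonnegative, the mass is
  nondecreasing from its initial value one; the growth lemma is applied to \<open>- Z\<close> with
  rate zero.\<close>

lemma Z_pos: assumes t: "0 \<le> t" "t \<le> \<beta>" shows "Z t > 0"
proof -
  have "- Z t \<le> exp (0 * t) * - Z 0"
  proof (rule gronwall_differential[where \<beta> = \<beta> and u = "\<lambda>t. - Z t"])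
    show "continuous_on {0..\<beta>} (\<lambda>t. - Z t)" using Z_cont by (intro continuous_intros)
    fix s assume s: "0 < s" "s < \<beta>"
    have "((\<lambda>t. - Z t) has_real_derivative (\<Sum>y\<in>S. H y * m s y)) (at s)"
      using DERIV_minus[OF Z_DERIV[OF s(1)]] by simp
    moreover have "(\<Sum>y\<in>S. H y * m s y) \<le> 0"
      using m_nonneg[of s] s ising_H_bounds(2) by (intro sum_nonpos mult_nonpos_nonneg) auto
    ultimately show "\<exists>u'. ((\<lambda>t. - Z t) has_real_derivative u') (at s) \<and> u' \<le> 0 * - Z s" by auto
  qed (use t in auto)
  then show ?thesis using m_init(2) by (simp add: Z_def)
qed

section \<open>The chi-square distance along the flow\<close>

definition X :: "real \<Rightarrow> real" where "X t = (\<Sum>y\<in>S. exp (t * H y) * (m t y)\<^sup>2)"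

text \<open>The chi-square distance in the form of the sum of \<open>\<nu>^2 / \<mu>\<close> minus
  one, with \<open>1 / \<mu> t = W t * exp (t * H)\<close>. It is thus a rational expression in
  three quantities that are differentiated separately.\<close>

definition e :: "real \<Rightarrow> real" where "e t = X t * W t / (Z t)\<^sup>2 - 1"

lemma chi_square_eq: "0 \<le> t \<Longrightarrow> t \<le> \<beta> \<Longrightarrow> chi_square S (\<lambda>y. m t y / Z t) (\<mu> t) = e t"
proof -
  assume t: "0 \<le> t" "t \<le> \<beta>"
  have Z: "Z t \<noteq> 0" using Z_pos[OF t] by simp
  have "(m t y / Z t / \<mu> t y - 1)\<^sup>2 * \<mu> t y
     = exp (t * H y) * (m t y)\<^sup>2 * W t / (Z t)\<^sup>2 - 2 * (m t y / Z t) + \<mu> t y" if y: "y \<in> S" for y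
  proof -
    have p: "\<mu> t y > 0" using ising_mu_pos[OF y] .
    have "exp (t * H y) * W t * \<mu> t y = exp (t * H y) * exp (- t * H y)"
      using \<mu>_W[OF y, of t] by simp
    also have "\<dots> = 1" by (simp add: exp_add[symmetric])
    finally have "exp (t * H y) * W t = 1 / \<mu> t y" using p by (simp add: field_simps)
    then have "exp (t * H y) * (m t y)\<^sup>2 * W t / (Z t)\<^sup>2 = (m t y)\<^sup>2 / \<mu> t y / (Z t)\<^sup>2"
      by (metis mult.assoc mult.commute mult.left_neutral times_divide_eq_left)
    then show ?thesis using p Z by (simp add: field_simps power2_eq_square)
  qed
  then have "chi_square S (\<lambda>y. m t y / Z t) (\<mu> t)
     = (\<Sum>y\<in>S. exp (t * H y) * (m t y)\<^sup>2 * W t / (Z t)\<^sup>2 - 2 * (m t y / Z t) + \<mu> t y)"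
    by (simp add: chi_square_def)
  also have "\<dots> = X t * W t / (Z t)\<^sup>2 - 2 * (Z t / Z t) + 1"
    unfolding sum.distrib sum_subtractf sum_ising_mu
    by (simp only: X_def Z_def sum_distrib_right sum_divide_distrib sum_distrib_left)
  finally show ?thesis using Z by (simp add: e_def)
qed

lemma e_nonneg: "0 \<le> t \<Longrightarrow> t \<le> \<beta> \<Longrightarrow> e t \<ge> 0"
  unfolding chi_square_eq[symmetric] chi_square_def
  by (intro sum_nonneg mult_nonneg_nonneg) (auto simp: ising_mu_pos less_imp_le)

lemma e_cont: "continuous_on {0..\<beta>} e"
proof -
  have "Z t \<noteq> 0" if "t \<in> {0..\<beta>}" for t using Z_pos[of t] that by auto
  then show ?thesis unfolding e_def X_def W_def
    by (intro continuous_intros m_cont Z_cont) auto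
qed

lemma e_DERIV:
  assumes t: "0 < t" "t < \<beta>"
  shows "\<exists>e'. (e has_real_derivative e') (at t) \<and> e' \<le> e t * (1 + e t) / (2 * \<beta>)"
proof -
  have t': "0 \<le> t" "t \<le> \<beta>" using t by auto
  define z where "z = Z t"
  define w where "w = W t"
  have z: "z > 0" and w: "w > 0" using Z_pos[OF t'] W_pos by (auto simp: z_def w_def)
  define f where "f y = m t y / z / \<mu> t y - 1" for y
  have m_f: "m t y = z * (\<mu> t y * (1 + f y))" if "y \<in> S" for y
    using ising_mu_pos[OF that, of t] z by (simp add: f_def)
  define av where "av g = (\<Sum>y\<in>S. \<mu> t y * g y)" for g
  have av_add: "av (\<lambda>x. g x + k x) = av g + av k" and av_cm: "av (\<lambda>x. c * g x) = c * av g" for g k c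
    by (auto simp: av_def sum.distrib[symmetric] sum_distrib_left algebra_simps)
  have av1: "av (\<lambda>_. 1) = 1" by (simp add: av_def sum_ising_mu)
  have mean: "av f = 0"
  proof -
    have "z = (\<Sum>y\<in>S. z * (\<mu> t y * (1 + f y)))" using m_f by (simp add: z_def Z_def)
    also have "\<dots> = z * av (\<lambda>y. 1 + f y)" by (simp add: av_def sum_distrib_left)
    finally show ?thesis using z by (simp add: av_add av1)
  qed
  have e: "e t = av (\<lambda>y. (f y)\<^sup>2)"
    unfolding chi_square_eq[OF t', symmetric] chi_square_def av_def f_def z_def by (simp add: mult.commute)
  define Hm where "Hm = av H"
  define h1 where "h1 = av (\<lambda>y. H y * f y)"
  define h2 where "h2 = av (\<lambda>y. H y * (f y)\<^sup>2)"
  define D where "D = (\<Sum>x\<in>S. \<mu> t x * f x * mat_fun S (L t) f x)"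
  define G where "G y = exp (t * H y) * m t y" for y
  have G_f: "G y = z / w * (1 + f y)" if "y \<in> S" for y
  proof -
    have "G y = z * (exp (t * H y) * \<mu> t y) * (1 + f y)" by (simp add: G_def m_f[OF that])
    also have "exp (t * H y) * \<mu> t y = exp (t * H y) * exp (- t * H y) / w"
      using \<mu>_W[OF that, of t] w by (simp add: w_def)
    also have "\<dots> = 1 / w" by (simp add: exp_add[symmetric])
    finally show ?thesis by simp
  qed
  have X_e: "X t = z\<^sup>2 / w * (1 + e t)"
    using w z by (simp add: e_def z_def[symmetric] w_def[symmetric] field_simps)
  have Zd: "(Z has_real_derivative - (z * (Hm + h1))) (at t)"
  proof -
    have "(\<Sum>y\<in>S. H y * m t y) = z * av (\<lambda>y. H y + H y * f y)"
      unfolding av_def sum_distrib_left using m_f by (intro sum.cong) (auto simp: algebra_simps)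
    then show ?thesis using Z_DERIV[OF t(1)] by (simp add: av_add Hm_def h1_def)
  qed
  have Wd: "(W has_real_derivative - (w * Hm)) (at t)"
  proof -
    have "(W has_real_derivative (\<Sum>y\<in>S. - H y * exp (- t * H y))) (at t)"
      unfolding W_def by (intro DERIV_sum) (auto intro!: derivative_eq_intros)
    also have "(\<Sum>y\<in>S. - H y * exp (- t * H y)) = - (w * Hm)"
      unfolding Hm_def av_def sum_distrib_left sum_negf[symmetric]
    proof (intro sum.cong refl)
      fix y assume "y \<in> S"
      from \<mu>_W[OF this, of t] have "- H y * exp (- t * H y) = - H y * (w * \<mu> t y)"
        by (simp only: w_def)
      then show "- H y * exp (- t * H y) = - (w * (\<mu> t y * H y))"
        by (simp only: mult_minus_left mult.commute[of "H y"] mult.assoc)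
    qed
    finally show ?thesis .
  qed
  have Xd: "(X has_real_derivative z\<^sup>2 / w * (2 * M t * D - (Hm + 2 * h1 + h2))) (at t)"
  proof -
    have "(X has_real_derivative (\<Sum>y\<in>S. exp (t * H y) * (2 * m t y * dm t y) + H y * exp (t * H y) * (m t y)\<^sup>2)) (at t)"
      unfolding X_def
    proof (intro DERIV_sum)
      fix y assume y: "y \<in> S"
      show "((\<lambda>t. exp (t * H y) * (m t y)\<^sup>2) has_real_derivative
          exp (t * H y) * (2 * m t y * dm t y) + H y * exp (t * H y) * (m t y)\<^sup>2) (at t)"
        by (rule derivative_eq_intros m_DERIV[OF t(1) y] refl)+ (simp add: algebra_simps)
    qed
    also have "(\<Sum>y\<in>S. exp (t * H y) * (2 * m t y * dm t y) + H y * exp (t * H y) * (m t y)\<^sup>2)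
      = 2 * (\<Sum>y\<in>S. dm t y * G y) + (\<Sum>y\<in>S. H y * m t y * G y)"
      unfolding sum_distrib_left sum.distrib[symmetric]
      by (intro sum.cong) (auto simp: G_def algebra_simps power2_eq_square)
    also have "\<dots> = 2 * M t * (\<Sum>y\<in>S. m t y * mat_fun S (L t) G y) - (\<Sum>y\<in>S. H y * m t y * G y)"
      unfolding dm_test by simp
    also have "(\<Sum>y\<in>S. H y * m t y * G y) = z\<^sup>2 / w * (Hm + 2 * h1 + h2)"
    proof -
      have "(\<Sum>y\<in>S. H y * m t y * G y) = z\<^sup>2 / w * av (\<lambda>y. H y + 2 * (H y * f y) + H y * (f y)\<^sup>2)"
        unfolding av_def sum_distrib_left using m_f G_f
        by (intro sum.cong) (auto simp: algebra_simps power2_eq_square add_divide_distrib)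
      then show ?thesis by (simp add: av_add av_cm Hm_def h1_def h2_def)
    qed
    also have "(\<Sum>y\<in>S. m t y * mat_fun S (L t) G y) = z\<^sup>2 / w * D"
    proof -
      have "(\<Sum>y\<in>S. m t y * mat_fun S (L t) G y) = z * (\<Sum>y\<in>S. \<mu> t y * (1 + f y) * mat_fun S (L t) G y)"
        unfolding sum_distrib_left by (intro sum.cong) (auto simp: m_f)
      \<comment> \<open>The Dirichlet form sees only differences, so \<open>1 + f\<close> may be
        replaced by \<open>f\<close> and \<open>G\<close> by \<open>z / w * f\<close>.\<close>
      also have "(\<Sum>y\<in>S. \<mu> t y * (1 + f y) * mat_fun S (L t) G y) = z / w * D"
      proof -
        have "(G x - G y) = z / w * (f x - f y)" if "x \<in> S" "y \<in> S" for x y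
          using G_f that by (simp add: algebra_simps)
        then have "(\<Sum>x\<in>S. \<Sum>y\<in>S. hypercube_kernel N x y * min (\<mu> t x) (\<mu> t y) * (((1 + f x) - (1 + f y)) * (G x - G y)))
          = z / w * (\<Sum>x\<in>S. \<Sum>y\<in>S. hypercube_kernel N x y * min (\<mu> t x) (\<mu> t y) * ((f x - f y) * (f x - f y)))"
          unfolding sum_distrib_left by (intro sum.cong refl) simp
        then show ?thesis unfolding D_def ising_gen_dirichlet by simp
      qed
      finally show ?thesis by (simp add: power2_eq_square)
    qed
    finally show ?thesis by (simp add: algebra_simps)
  qed
  define e' where "e' = 2 * M t * D + 2 * h1 * e t - (h2 - Hm * e t)"
  have "(e has_real_derivative e') (at t)"
  proof -
    define dx where "dx = z\<^sup>2 / w * (2 * M t * D - (Hm + 2 * h1 + h2))"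
    have "(e has_real_derivative ((dx * w + (- (w * Hm)) * X t) * z\<^sup>2 - X t * w * (2 * (- (z * (Hm + h1))) * z)) / (z\<^sup>2 * z\<^sup>2)) (at t)"
      unfolding e_def
      using Xd Wd Zd z unfolding z_def[symmetric] w_def[symmetric] dx_def[symmetric]
      by (auto intro!: derivative_eq_intros simp: z_def[symmetric] w_def[symmetric] power2_eq_square)
    also have "((dx * w + (- (w * Hm)) * X t) * z\<^sup>2 - X t * w * (2 * (- (z * (Hm + h1))) * z)) / (z\<^sup>2 * z\<^sup>2)
      = dx * w / z\<^sup>2 + (X t * w / z\<^sup>2) * (- Hm + 2 * (Hm + h1))"
      using z by (simp add: field_simps power2_eq_square)
    also have "X t * w / z\<^sup>2 = 1 + e t" using z w by (simp add: X_e)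
    also have "dx * w / z\<^sup>2 = 2 * M t * D - (Hm + 2 * h1 + h2)" using z w by (simp add: dx_def)
    \<comment> \<open>The terms \<open>Hm\<close> and \<open>2 * h1\<close> of order zero and one in
      \<open>f\<close> cancel between the derivatives of \<open>X\<close>, \<open>W\<close> and
      \<open>Z\<close>; what remains is the expression estimated by
      \<open>ising_drift_bound\<close>.\<close>
    also have "2 * M t * D - (Hm + 2 * h1 + h2) + (1 + e t) * (- Hm + 2 * (Hm + h1)) = e'"
      by (simp add: e'_def algebra_simps)
    finally show ?thesis .
  qed
  moreover have "e' \<le> e t * (1 + e t) / (2 * \<beta>)"
  proof -
    have "av (\<lambda>y. (H y - Hm) * (f y)\<^sup>2) = av (\<lambda>y. H y * (f y)\<^sup>2 + (- Hm) * (f y)\<^sup>2)"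
      by (simp add: algebra_simps)
    then have h: "av (\<lambda>y. (H y - Hm) * (f y)\<^sup>2) = h2 - Hm * e t"
      by (simp only: av_add av_cm h2_def e)
    show ?thesis
      using ising_drift_bound[OF t'(1) N \<beta> M0[OF t] mean[unfolded av_def]] h
      unfolding e'_def e D_def h1_def Hm_def av_def by (simp add: mult.assoc)
  qed
  ultimately show ?thesis by blast
qed

text \<open>The substitution \<open>e / (1 + e)\<close> linearises the Bernoulli type inequality.
  Undoing it requires a positive lower bound on \<open>1 - (c - 1) * e 0\<close>, which is where
  \<open>e 0 \<le> 1\<close> enters.\<close>

lemma e_bound:
  assumes e0: "e 0 \<le> 1" and t: "0 \<le> t" "t \<le> \<beta>"
  shows "e t \<le> exp 2 * e 0"
proof -
  define \<theta> where "\<theta> s = e s / (1 + e s)" for s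
  define c where "c = exp (1 / 2 :: real)"
  have "\<theta> t \<le> exp (1 / (2 * \<beta>) * t) * \<theta> 0"
  proof (rule gronwall_differential[where \<beta> = \<beta> and u = \<theta>])
    show "continuous_on {0..\<beta>} \<theta>" unfolding \<theta>_def
      using e_nonneg by (intro continuous_intros e_cont) (auto simp: add_nonneg_eq_0_iff)
    fix s assume s: "0 < s" "s < \<beta>"
    obtain e' where e': "(e has_real_derivative e') (at s)" "e' \<le> e s * (1 + e s) / (2 * \<beta>)"
      using e_DERIV[OF s] by blast
    have p: "1 + e s > 0" using e_nonneg[of s] s by simp
    have "(\<theta> has_real_derivative e' / (1 + e s)\<^sup>2) (at s)"
      unfolding \<theta>_def using p e'(1)
      by (auto intro!: derivative_eq_intros simp: power2_eq_square algebra_simps)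
    moreover have "e' / (1 + e s)\<^sup>2 \<le> 1 / (2 * \<beta>) * \<theta> s"
    proof -
      have "e' / (1 + e s)\<^sup>2 \<le> e s * (1 + e s) / (2 * \<beta>) / (1 + e s)\<^sup>2"
        using e'(2) by (intro divide_right_mono) auto
      also have "\<dots> = 1 / (2 * \<beta>) * \<theta> s" using p by (simp add: \<theta>_def power2_eq_square)
      finally show ?thesis .
    qed
    ultimately show "\<exists>u'. (\<theta> has_real_derivative u') (at s) \<and> u' \<le> 1 / (2 * \<beta>) * \<theta> s" by blast
  qed (use t in auto)
  also have "\<dots> \<le> c * \<theta> 0"
  proof (rule mult_right_mono)
    show "exp (1 / (2 * \<beta>) * t) \<le> c" unfolding c_def using t \<beta> by (simp add: divide_simps)
    show "0 \<le> \<theta> 0" using e_nonneg[of 0] \<beta> by (simp add: \<theta>_def)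
  qed
  finally have th: "e t / (1 + e t) \<le> c * (e 0 / (1 + e 0))" by (simp add: \<theta>_def)
  have n0: "e 0 \<ge> 0" "e t \<ge> 0" using e_nonneg t \<beta> by auto
  have c2: "c\<^sup>2 = exp 1" by (simp add: c_def power2_eq_square exp_add[symmetric])
  \<comment> \<open>The square of \<open>33 / 20\<close> is \<open>1089 / 400 = 2.7225\<close>, just
    above the bound \<open>2.72\<close> for Euler's number. The resulting factor is
    \<open>(33 / 20) / (7 / 20) = 33 / 7 < 5\<close>, and \<open>exp 2\<close> exceeds
    \<open>(5 / 2)^2\<close>.\<close>
  have e1: "exp (1 :: real) \<le> 1089 / 400" using e_less_272 by simp
  have c1: "1 \<le> c" by (simp add: c_def)
  have c: "c \<le> (33 / 20)"
  proof (rule power2_le_imp_le)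
    show "c\<^sup>2 \<le> (33 / 20)\<^sup>2" unfolding c2 using e1 by (simp add: power2_eq_square)
  qed simp
  have "e t * (1 + e 0) \<le> c * e 0 * (1 + e t)"
    using th n0 by (simp add: field_simps)
  then have "e t * (1 - (c - 1) * e 0) \<le> c * e 0" by (simp add: algebra_simps)
  moreover have "(c - 1) * e 0 \<le> (13 / 20) * 1" using c c1 n0 e0 by (intro mult_mono) auto
  then have "e t * (7 / 20) \<le> e t * (1 - (c - 1) * e 0)" using n0 by (intro mult_left_mono) auto
  moreover have "c * e 0 \<le> (33 / 20) * e 0" using c n0 by (intro mult_right_mono)
  ultimately have 1: "e t \<le> 5 * e 0" using n0 by linarith
  have "(5 :: real) \<le> exp 2"
  proof -
    have "(1 + 1 + 1 / 2 :: real)\<^sup>2 \<le> (exp 1)\<^sup>2"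
      using exp_lower_Taylor_quadratic[of "1 :: real"] by (intro power_mono) auto
    also have "(exp 1 :: real)\<^sup>2 = exp 2" by (simp add: power2_eq_square exp_add[symmetric])
    finally show ?thesis by (simp add: power2_eq_square)
  qed
  then have "5 * e 0 \<le> exp 2 * e 0" using n0 by (intro mult_right_mono)
  with 1 show ?thesis by linarith
qed

end

theorem theorem14:
  fixes N :: nat
    and M :: "real \<Rightarrow> real"
    and p :: "real \<Rightarrow> real \<Rightarrow> (nat \<Rightarrow> real) \<Rightarrow> (nat \<Rightarrow> real) \<Rightarrow> real"
    and \<nu> :: "(nat \<Rightarrow> real) pmf"
    and \<nu>t :: "real \<Rightarrow> (nat \<Rightarrow> real) \<Rightarrow> real"
    and \<epsilon> :: "real \<Rightarrow> real"
    and \<beta> :: real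
  assumes "odd N"
    and "continuous_on {0..} M"
    and "\<And>t. t \<ge> 0 \<Longrightarrow> M t \<ge> 0"
    and "is_propagator (spins N) M (ising_gen N) (ising_H N) p"
    and "set_pmf \<nu> \<subseteq> spins N"
    and "\<And>t. \<nu>t t = Phi (spins N) p 0 t (pmf \<nu>)"
    and "\<And>t. \<epsilon> t = chi_square (spins N) (\<nu>t t) (ising_mu N t)"
    and "\<beta> > 0"
    and "\<epsilon> 0 \<le> 1"
    and "\<And>t. t \<in> {0<..<\<beta>} \<Longrightarrow> M t \<ge> 9 / 4 * real N ^ 3 + 9 / 8 * \<beta> * real N ^ 4"
  shows "(SUP t\<in>{0..\<beta>}. ereal (\<epsilon> t)) \<le> ereal (exp 2 * \<epsilon> 0)"
proof -
  obtain n where n: "N = 2 * n + 1" using assms(1) by (rule oddE)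
  define m where "m t = meas_mat (spins N) (pmf \<nu>) (p 0 t)" for t
  note deriv = propagated_measure_deriv[OF assms(4) finite_spins]
  interpret ising_flow N n \<beta> M m
  proof
    show "(\<Sum>y\<in>spins N. m 0 y) = 1"
      using sum_pmf_eq_1[OF finite_spins assms(5)] by (simp add: m_def deriv(2)[OF order_refl])
    show "0 \<le> m 0 y" if "y \<in> spins N" for y using deriv(2)[OF order_refl that] by (simp add: m_def)
  qed (use n assms(8,10) deriv(1) in \<open>auto simp: m_def\<close>)
  have \<epsilon>: "\<epsilon> t = e t" if "t \<in> {0..\<beta>}" for t
  proof -
    have "\<nu>t t = (\<lambda>y. m t y / Z t)" by (simp add: assms(6) Phi_def m_def Z_def fun_eq_iff)
    then show ?thesis using chi_square_eq that by (simp add: assms(7))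
  qed
  have "\<epsilon> t \<le> exp 2 * \<epsilon> 0" if "t \<in> {0..\<beta>}" for t
    using e_bound[of t] that \<epsilon>[of t] \<epsilon>[of 0] assms(8,9) by simp
  then show ?thesis by (intro SUP_least) simp
qed

end
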